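(* For every prime $p\ge5$, the graph $\mathcal{C}_p(X)$, the regular $\mathbb{Z}_p$-cover of $X=\mathcal{Y}(4,48;13,44)$ defined in the context, is a connected quartic half-arc-transitive weak metacirculant of Class II with radius $12$ and attachment number $3$. Consequently there exist infinitely many connected quartic half-arc-transitive weak metacirculants of Class II which are not tightly attached.
   Context: All graphs are finite, simple and undirected. Quartic means regular of valency $4$. A graph is half-arc-transitive if its automorphism group is transitive on vertices and on edges but not on arcs. Automorphisms act on the right. The graph $X=\mathcal{Y}(4,48;13,44)$ has vertex set $\{u_i^j : i\in\mathbb{Z}_4,\ j\in\mathbb{Z}_{48}\}$ and edges $u_i^j\sim u_i^{j+13^i},\ u_{i+1}^j$ for $i\ne3$, and $u_3^j\sim u_3^{j+13^3},\ u_0^{j+44}$. Orient its edges by $u_i^j\to u_i^{j+13^i}$ for all $i$, $u_i^j\to u_{i+1}^j$ for $i\neq 3$, and $u_3^j\to u_0^{j+44}$ (the orientation corresponding to the half-arc-transitive action of $\mathrm{Aut}\,X$ with $u_0^0\to u_0^1$). For a prime $p\ge5$, $\mathcal{C}_p(X)$ is the $\mathbb{Z}_p$-cover of $X$ obtained by assigning voltage $1\in\mathbb{Z}_p$ to every arc compatible with this orientation (and $-1$ to the reverse arcs). Explicitly, $\mathcal{C}_p(X)$ has vertex set $\{{}^ku_i^j : i\in\mathbb{Z}_4,\ j\in\mathbb{Z}_{48},\ k\in\mathbb{Z}_p\}$ and edges joining ${}^ku_i^j$ to ${}^{k+1}u_i^{j+13^i}$ for all $i$, ${}^ku_i^j$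 to ${}^{k+1}u_{i+1}^j$ for $i\ne3$, and ${}^ku_3^j$ to ${}^{k+1}u_0^{j+44}$. Weak metacirculants. For integers $m\ge 1$, $n\ge 2$, an automorphism is $(m,n)$-semiregular if it has $m$ orbits of length $n$ on vertices and no other orbit. A graph is a weak $(m,n)$-metacirculant relative to the pair $(\rho,\sigma)$ of automorphisms if $\rho$ is $(m,n)$-semiregular, $\sigma^{-1}\rho\sigma=\rho^r$ for some $r\in\mathbb{Z}_n^*$, and $\sigma$ cyclically permutes the orbits of $\rho$. A connected quartic half-arc-transitive weak metacirculant is of Class II if, for some such $m,n,\rho,\sigma$, each orbit of $\rho$ induces a subgraph of valency $2$ and each orbit is joined to exactly two other orbits, each vertex having exactly one neighbour in each of these two other orbits. Attachment. Fix one of the two $\mathrm{Aut}$-invariant orientations of the edges of a connected quartic half-arc-transitive graph. An even-length cycle $C$ is an alternating cycle if every other vertex of $C$ is the tail, and every other vertex is the head, of its two incident edges on $C$. All alternating cycles have the same length, half of which is the radius; any two adjacent (distinct, intersecting) alternating cycles meet in the same number of vertices, the attachment number. The graph is tightly attached if its attachment number equals its radius. *)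

theory Defs
  imports
    "Graph_Theory.Graph_Theory"
    "HOL-Combinatorics.Orbits"
    "HOL-Computational_Algebra.Primes"
begin

text \<open>A finite simple undirected graph is a \<open>pair_graph\<close>: a finite, loopless, symmetric
  digraph whose arcs are ordered pairs of vertices. An undirected edge is a pair of opposite arcs.\<close>

definition regular_of_valency :: "nat \<Rightarrow> ('a, 'b) pre_digraph \<Rightarrow> bool" where
  "regular_of_valency d G \<longleftrightarrow> (\<forall>v \<in> verts G. out_degree G v = d)"

text \<open>Automorphisms are taken to be the identity outside the vertex set, so that they form a
  group of permutations under composition.\<close>

definition automorphisms :: "'a pair_pre_digraph \<Rightarrow> ('a \<Rightarrow> 'a) set" where
  "automorphisms G = {f. f permutes pverts G \<and>
     (\<forall>u \<in> pverts G. \<forall>v \<in> pverts G. (f u, f v) \<in> parcs G \<longleftrightarrow> (u, v) \<in> parcs G)}"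

definition vertex_transitive :: "'a pair_pre_digraph \<Rightarrow> bool" where
  "vertex_transitive G \<longleftrightarrow>
     (\<forall>u \<in> pverts G. \<forall>v \<in> pverts G. \<exists>f \<in> automorphisms G. f u = v)"

definition edge_transitive :: "'a pair_pre_digraph \<Rightarrow> bool" where
  "edge_transitive G \<longleftrightarrow>
     (\<forall>(u, v) \<in> parcs G. \<forall>(x, y) \<in> parcs G. \<exists>f \<in> automorphisms G. {f u, f v} = {x, y})"

definition arc_transitive :: "'a pair_pre_digraph \<Rightarrow> bool" where
  "arc_transitive G \<longleftrightarrow>
     (\<forall>(u, v) \<in> parcs G. \<forall>(x, y) \<in> parcs G. \<exists>f \<in> automorphisms G. f u = x \<and> f v = y)"

definition half_arc_transitive :: "'a pair_pre_digraph \<Rightarrow> bool" where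
  "half_arc_transitive G \<longleftrightarrow>
     vertex_transitive G \<and> edge_transitive G \<and> \<not> arc_transitive G"

definition connected_quartic_half_arc_transitive :: "'a pair_pre_digraph \<Rightarrow> bool" where
  "connected_quartic_half_arc_transitive G \<longleftrightarrow>
     pair_graph G \<and> connected (with_proj G) \<and> regular_of_valency 4 (with_proj G) \<and>
     half_arc_transitive G"


text \<open>Weak metacirculants\<close>

definition orbits_of :: "'a pair_pre_digraph \<Rightarrow> ('a \<Rightarrow> 'a) \<Rightarrow> 'a set set" where
  "orbits_of G \<rho> = orbit \<rho> ` pverts G"

definition semiregular :: "nat \<Rightarrow> nat \<Rightarrow> 'a pair_pre_digraph \<Rightarrow> ('a \<Rightarrow> 'a) \<Rightarrow> bool" where
  "semiregular m n G \<rho> \<longleftrightarrow>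
     \<rho> \<in> automorphisms G \<and> card (orbits_of G \<rho>) = m \<and> (\<forall>B \<in> orbits_of G \<rho>. card B = n)"

text \<open>Automorphisms act on the right, so the product \<open>\<sigma>\<^sup>-\<^sup>1 \<rho> \<sigma>\<close> applies \<open>\<sigma>\<^sup>-\<^sup>1\<close> first.\<close>

definition weak_metacirculant ::
  "nat \<Rightarrow> nat \<Rightarrow> 'a pair_pre_digraph \<Rightarrow> ('a \<Rightarrow> 'a) \<Rightarrow> ('a \<Rightarrow> 'a) \<Rightarrow> bool" where
  "weak_metacirculant m n G \<rho> \<sigma> \<longleftrightarrow>
     1 \<le> m \<and> 2 \<le> n \<and> semiregular m n G \<rho> \<and> \<sigma> \<in> automorphisms G \<and>
     (\<exists>r < n. coprime r n \<and> \<sigma> \<circ> \<rho> \<circ> inv \<sigma> = \<rho> ^^ r) \<and>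
     cyclic_on ((`) \<sigma>) (orbits_of G \<rho>)"

definition adjacent_orbits :: "'a pair_pre_digraph \<Rightarrow> ('a \<Rightarrow> 'a) \<Rightarrow> 'a set \<Rightarrow> 'a set set" where
  "adjacent_orbits G \<rho> B =
     {B' \<in> orbits_of G \<rho>. B' \<noteq> B \<and> (\<exists>u \<in> B. \<exists>v \<in> B'. (u, v) \<in> parcs G)}"

definition class_II_weak_metacirculant :: "'a pair_pre_digraph \<Rightarrow> bool" where
  "class_II_weak_metacirculant G \<longleftrightarrow>
     (\<exists>m n \<rho> \<sigma>. weak_metacirculant m n G \<rho> \<sigma> \<and>
        (\<forall>B \<in> orbits_of G \<rho>.
           regular_of_valency 2 (with_proj G \<restriction> B) \<and>
           card (adjacent_orbits G \<rho> B) = 2 \<and>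
           (\<forall>B' \<in> adjacent_orbits G \<rho> B. \<forall>u \<in> B. card {v \<in> B'. (u, v) \<in> parcs G} = 1)))"


text \<open>Alternating cycles, radius and attachment number\<close>

definition invariant_orientation :: "'a pair_pre_digraph \<Rightarrow> ('a \<times> 'a) set \<Rightarrow> bool" where
  "invariant_orientation G D \<longleftrightarrow>
     D \<union> D\<inverse> = parcs G \<and> D \<inter> D\<inverse> = {} \<and>
     (\<forall>f \<in> automorphisms G. \<forall>(u, v) \<in> D. (f u, f v) \<in> D)"

text \<open>An alternating cycle is a subgraph, given by its set of undirected edges; a closed walk \<open>p\<close>
  traversing it is chosen to start at a tail. The bound on the length is needed because the
  library also counts \<open>[(u, v), (v, u)]\<close> as a cycle of a symmetric digraph.\<close>

definition alternating_cycles ::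
  "'a pair_pre_digraph \<Rightarrow> ('a \<times> 'a) set \<Rightarrow> 'a set set set" where
  "alternating_cycles G D =
     {(\<lambda>(u, v). {u, v}) ` set p | p.
        pre_digraph.cycle (with_proj G) p \<and> 3 \<le> length p \<and> even (length p) \<and>
        (\<forall>i < length p. if even i then p ! i \<in> D else prod.swap (p ! i) \<in> D)}"

text \<open>The two invariant orientations of a connected quartic half-arc-transitive graph are
  converse to each other and have the same alternating cycles, so it does not matter which one
  is fixed in the following two definitions. The nonemptiness conditions exclude vacuous values.\<close>

definition has_radius :: "'a pair_pre_digraph \<Rightarrow> nat \<Rightarrow> bool" where
  "has_radius G r \<longleftrightarrow>
     (\<exists>D. invariant_orientation G D \<and> alternating_cycles G D \<noteq> {} \<and>
        (\<forall>C \<in> alternating_cycles G D. card C = 2 * r))"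

definition adjacent_cycles :: "'a set set \<Rightarrow> 'a set set \<Rightarrow> bool" where
  "adjacent_cycles C C' \<longleftrightarrow> C \<noteq> C' \<and> \<Union>C \<inter> \<Union>C' \<noteq> {}"

definition has_attachment_number :: "'a pair_pre_digraph \<Rightarrow> nat \<Rightarrow> bool" where
  "has_attachment_number G a \<longleftrightarrow>
     (\<exists>D. invariant_orientation G D \<and>
        (\<exists>C \<in> alternating_cycles G D. \<exists>C' \<in> alternating_cycles G D. adjacent_cycles C C') \<and>
        (\<forall>C \<in> alternating_cycles G D. \<forall>C' \<in> alternating_cycles G D.
           adjacent_cycles C C' \<longrightarrow> card (\<Union>C \<inter> \<Union>C') = a))"

definition tightly_attached :: "'a pair_pre_digraph \<Rightarrow> bool" where
  "tightly_attached G \<longleftrightarrow> (\<exists>r. has_radius G r \<and> has_attachment_number G r)"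


text \<open>The graphs \<open>\<Y>(m,n;r,t)\<close>, with \<open>(i, j)\<close> standing for the vertex \<open>u\<^sub>i\<^sup>j\<close>; residues are
  represented by their least nonnegative representatives.\<close>

definition Y_verts :: "nat \<Rightarrow> nat \<Rightarrow> (nat \<times> nat) set" where
  "Y_verts m n = {..<m} \<times> {..<n}"

definition Y_orientation ::
  "nat \<Rightarrow> nat \<Rightarrow> nat \<Rightarrow> nat \<Rightarrow> ((nat \<times> nat) \<times> (nat \<times> nat)) set" where
  "Y_orientation m n r t =
     {((i, j), (i, (j + r ^ i) mod n)) | i j. i < m \<and> j < n} \<union>
     {((i, j), (i + 1, j)) | i j. i < m \<and> i \<noteq> m - 1 \<and> j < n} \<union>
     {((m - 1, j), (0, (j + t) mod n)) | j. j < n}"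

definition underlying_graph :: "'a set \<Rightarrow> ('a \<times> 'a) set \<Rightarrow> 'a pair_pre_digraph" where
  "underlying_graph V D = \<lparr> pverts = V, parcs = D \<union> D\<inverse> \<rparr>"

text \<open>The \<open>\<int>\<^sub>p\<close>-cover of the graph underlying \<open>(V, D)\<close> in which every arc of \<open>D\<close> has voltage 1 and
  every reverse arc has voltage \<open>-1\<close>; \<open>(v, k)\<close> is the vertex in the fibre of \<open>v\<close> with label \<open>k\<close>.\<close>

definition unit_voltage_cover ::
  "nat \<Rightarrow> 'a set \<Rightarrow> ('a \<times> 'a) set \<Rightarrow> ('a \<times> nat) pair_pre_digraph" where
  "unit_voltage_cover p V D =
     underlying_graph (V \<times> {..<p}) {((u, k), (v, (k + 1) mod p)) | u v k. (u, v) \<in> D \<and> k < p}"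

definition C_cover :: "nat \<Rightarrow> ((nat \<times> nat) \<times> nat) pair_pre_digraph" where
  "C_cover p = unit_voltage_cover p (Y_verts 4 48) (Y_orientation 4 48 13 44)"

end

theory Submission
  imports Defs "HOL-Number_Theory.Cong"
begin

text \<open>Put \<open>m = j - i\<close> in \<open>u\<^sub>i\<^sup>j\<close>. A vertex of the cover then becomes a triple
  \<open>(i, m, k)\<close> modulo \<open>(4, 48, p)\<close>, with no exceptional row, and the two outgoing arcs
  are \<open>Ring: (i, m, k) \<mapsto> (i, m + 1 + 12 i, k + 1)\<close> and
  \<open>Spoke: (i, m, k) \<mapsto> (i + 1, m - 1, k + 1)\<close>. So the cover is a Cayley graph of a group
  generated by \<open>Ring\<close> and \<open>Spoke\<close> whose commutator is central of order 4, and every position can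
  be computed from a Heisenberg-type normal form of the word that leads to it.

  Symmetry is explicit: left translations of the group (\<open>shift\<close>) act transitively on the arcs of each of
  the two kinds, and the group automorphism exchanging the two generators (\<open>exchange\<close>) identifies
  the two kinds. Together they are transitive on the arcs of the orientation (\<open>D_transitive\<close>), and two
  of the translations exhibit the metacirculant structure, with the layers of constant \<open>i\<close> as orbits.

  The point is that no automorphism reverses an arc, and this cannot be seen locally: inverting both
  generators respects all short relations. The proof has a local and a global half. Locally, a word of
  length at most 8 is closed iff both exponent sums vanish and the enclosed area is divisible by 4
  (\<open>vtx_place_eq\<close>; as \<open>p \<ge> 5\<close>, such a word cannot close up by winding around the fibre). Counting closed
  8-walks shows that automorphisms respect straight paths, those repeating one generator
  (\<open>closed_8_walks\<close>), and comparing the images of two families of closed 8-walks shows that the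
  permutation of the four directions induced by an automorphism is the same at every vertex
  (\<open>relabel_step\<close>). Hence an automorphism maps the walk with a given word to the walk with the
  relabelled word (\<open>aut_walk\<close>). Globally, the word
  \<open>Ring\<^sup>7 Spoke\<^sup>-\<^sup>1 Ring Spoke\<^sup>-\<^sup>3\<close> raises \<open>k\<close> by 4 and changes nothing else, so
  its \<open>p\<close>-th power is closed. Under each of the six
  relabellings that do not preserve the orientation, the \<open>p\<close>-th power of the new word shifts \<open>m\<close>
  by \<open>p c\<close> with \<open>c\<close> not divisible by 48, so it is not closed as \<open>p\<close> is
  coprime to 48 (\<open>automorphism_D\<close>).

  The alternating cycles are the zigzags that alternate \<open>Ring\<close> and inverse \<open>Spoke\<close>. One step pair
  lowers \<open>i\<close> by 1, and the twelfth is the first to return, so they have length 24. Two different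
  ones meet only in the heads of one and the tails of the other, and solving the congruences leaves
  every fourth of the 12 heads. Finally, every invariant orientation is the given one or its
  converse and both have these alternating cycles, so radius 12 and attachment number 3 exclude
  tight attachment; orders of vertex sets separate the covers for different primes.\<close>

section \<open>Coordinates\<close>

datatype letter = Ring | Spoke | Ring' | Spoke'

fun inv_letter :: "letter \<Rightarrow> letter" where
  "inv_letter Ring = Ring'" | "inv_letter Spoke = Spoke'"
| "inv_letter Ring' = Ring" | "inv_letter Spoke' = Spoke"

definition forward :: "letter set" where
  "forward = {Ring, Spoke}"

fun go :: "letter \<Rightarrow> int \<times> int \<times> int \<Rightarrow> int \<times> int \<times> int" where
  "go Ring (i, m, k) = (i, m + 1 + 12 * i, k + 1)"
| "go Spoke (i, m, k) = (i + 1, m - 1, k + 1)"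
| "go Ring' (i, m, k) = (i, m - 1 - 12 * i, k - 1)"
| "go Spoke' (i, m, k) = (i - 1, m + 1, k - 1)"

lemma inv_letter_inv [simp]: "inv_letter (inv_letter l) = l"
  by (cases l) auto

lemma inv_letter_neq [simp]: "inv_letter l \<noteq> l" "l \<noteq> inv_letter l"
  by (cases l; simp)+

lemma inv_letter_inject [simp]: "inv_letter l = inv_letter l' \<longleftrightarrow> l = l'"
  by (metis inv_letter_inv)

lemma inv_letter_forward: "inv_letter l \<in> forward \<longleftrightarrow> l \<notin> forward"
  by (cases l) (auto simp: forward_def)

lemma UNIV_letter: "(UNIV :: letter set) = {Ring, Spoke, Ring', Spoke'}"
  using letter.exhaust by auto

lemma go_inv [simp]: "go (inv_letter l) (go l t) = t" "go l (go (inv_letter l) t) = t"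
  by (cases l; cases t; simp)+

locale voltage_prime =
  fixes p :: nat
  assumes prime: "prime p" and ge5: "5 \<le> p"
begin

abbreviation G :: "((nat \<times> nat) \<times> nat) pair_pre_digraph" where
  "G \<equiv> C_cover p"

abbreviation V :: "((nat \<times> nat) \<times> nat) set" where
  "V \<equiv> pverts G"

definition D :: "(((nat \<times> nat) \<times> nat) \<times> ((nat \<times> nat) \<times> nat)) set" where
  "D = {((u, k), (v, (k + 1) mod p)) | u v k. (u, v) \<in> Y_orientation 4 48 13 44 \<and> k < p}"

text \<open>The vertex \<open>((i, j), k)\<close> has coordinates \<open>(i, j - i, k)\<close>. With \<open>m = j - i\<close> the
  44, which is \<open>- 4\<close> modulo 48, that \<open>j\<close> gains when \<open>i\<close> passes from 3 to 0 is absorbed by the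
  reduction of \<open>i\<close> modulo 4.\<close>

fun vtx :: "int \<times> int \<times> int \<Rightarrow> (nat \<times> nat) \<times> nat" where
  "vtx (i, m, k) = ((nat (i mod 4), nat ((m + i mod 4) mod 48)), nat (k mod int p))"

fun rep :: "(nat \<times> nat) \<times> nat \<Rightarrow> int \<times> int \<times> int" where
  "rep ((i, j), k) = (int i, int j - int i, int k)"

definition act :: "letter \<Rightarrow> (nat \<times> nat) \<times> nat \<Rightarrow> (nat \<times> nat) \<times> nat" where
  "act l v = vtx (go l (rep v))"

lemma p_pos: "0 < p" "0 < int p"
  using ge5 by auto

lemma not_dvd: "\<not> p dvd 2" "\<not> p dvd 3"
  using ge5 by (auto dest: dvd_imp_le)

lemma coprime_48: "coprime (int p) 48"
proof -
  have "coprime p 2" "coprime p 3"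
    using not_dvd prime_imp_coprime[OF prime] by blast+
  then have "coprime p (2 ^ 4 * 3)"
    by (metis coprime_mult_right_iff coprime_power_right_iff)
  then have "coprime (int p) (int 48)"
    by (simp only: coprime_int_iff) simp
  then show ?thesis by simp
qed

lemma coprime_4: "coprime (int p) 4"
proof -
  have "coprime (int p) (4 * 12)"
    using coprime_48 by simp
  then show ?thesis
    by (simp only: coprime_mult_right_iff)
qed

lemma vtx_eq_iff:
  "vtx (i, m, k) = vtx (i', m', k') \<longleftrightarrow> 4 dvd i' - i \<and> 48 dvd m' - m \<and> int p dvd k' - k"
proof -
  have 1: "nat (x mod n) = nat (y mod n) \<longleftrightarrow> n dvd y - x" if "0 < n" for x y n :: int
    using that by (metis eq_nat_nat_iff mod_eq_dvd_iff pos_mod_sign)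
  have "48 dvd (m' + i' mod 4) - (m + i mod 4) \<longleftrightarrow> 48 dvd m' - m" if "4 dvd i' - i"
    using that by (simp add: mod_eq_dvd_iff[symmetric])
  then show ?thesis
    using 1[of 4 i i'] 1[of 48 "m + i mod 4" "m' + i' mod 4"] 1[of "int p" k k'] p_pos by auto
qed

lemma V_eq_Times: "V = ({..<4} \<times> {..<48}) \<times> {..<p}"
  by (simp add: C_cover_def unit_voltage_cover_def underlying_graph_def Y_verts_def)

lemma finite_V: "finite V"
  by (simp add: V_eq_Times)

lemma arcs_G: "parcs G = D \<union> D\<inverse>"
  by (simp add: C_cover_def unit_voltage_cover_def underlying_graph_def D_def)

lemma vtx_in_V [simp]: "vtx t \<in> V"
  using p_pos by (cases t) (auto simp: V_eq_Times nat_less_iff)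

lemma vtx_rep [simp]: "v \<in> V \<Longrightarrow> vtx (rep v) = v"
  by (auto simp: V_eq_Times)

lemma V_cases:
  assumes "v \<in> V" obtains t where "v = vtx t"
  using vtx_rep[OF assms] by metis

lemma V_eq: "V = range vtx"
  using vtx_in_V V_cases by (metis UNIV_I image_eqI image_subset_iff subsetI subset_antisym)

lemma vtx_go_cong: "vtx t = vtx t' \<Longrightarrow> vtx (go l t) = vtx (go l t')"
proof -
  assume a: "vtx t = vtx t'"
  obtain i m k i' m' k' where t: "t = (i, m, k)" "t' = (i', m', k')" by (cases t; cases t')
  have *: "4 dvd i' - i" "48 dvd m' - m" "int p dvd k' - k"
    using a by (auto simp: t vtx_eq_iff simp del: vtx.simps)
  then obtain x y where "i' = i + 4 * x" "m' = m + 48 * y"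
    by (metis dvdE diff_add_cancel add.commute)
  then have "(m' + 1 + 12 * i') - (m + 1 + 12 * i) = 48 * (x + y)"
    "(m' - 1 - 12 * i') - (m - 1 - 12 * i) = 48 * (y - x)"
    by simp_all
  then have "48 dvd (m' + 1 + 12 * i') - (m + 1 + 12 * i)" "48 dvd (m' - 1 - 12 * i') - (m - 1 - 12 * i)"
    by simp_all
  with * show ?thesis
    by (cases l) (simp_all add: t vtx_eq_iff del: vtx.simps)
qed

declare vtx.simps [simp del] rep.simps [simp del]

lemma act_vtx [simp]: "act l (vtx t) = vtx (go l t)"
  unfolding act_def by (rule vtx_go_cong) simp

lemma act_in_V [simp]: "act l v \<in> V"
  by (simp add: act_def)

lemma act_inv [simp]:
  assumes "v \<in> V" shows "act (inv_letter l) (act l v) = v" "act l (act (inv_letter l) v) = v"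
  using assms by (auto simp: V_eq)

lemma small_multiple: "int p dvd d \<Longrightarrow> \<bar>d\<bar> < 5 \<Longrightarrow> d = 0"
  using ge5 dvd_imp_le_int[of d "int p"] by linarith

lemma act_inject:
  assumes "v \<in> V" "act l v = act l' v" shows "l = l'"
proof -
  obtain i m k where v: "v = vtx (i, m, k)" using assms by (auto simp: V_eq)
  have "\<not> int p dvd 2" "\<not> int p dvd -2"
    using small_multiple[of 2] small_multiple[of "-2"] by auto
  with assms(2) show ?thesis
    by (cases l; cases l') (simp_all add: v vtx_eq_iff)
qed

lemma mod_shift: "x = y + n * c \<Longrightarrow> x mod n = y mod n" for x y n c :: int
  by simp

text \<open>Since \<open>12\<^sup>2\<close> is divisible by 48, \<open>13\<^sup>i\<close> and \<open>1 + 12 i\<close> agree modulo 48.\<close>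

lemma ring_residue:
  assumes "i < 4" shows "(1 + (int j + 12 * int i)) mod 48 = int ((j + 13 ^ i) mod 48)"
proof -
  have "i = 0 \<or> i = 1 \<or> i = 2 \<or> i = 3" using assms by auto
  then have "\<exists>c. (1 + (int j + 12 * int i)) = int (j + 13 ^ i) + 48 * c"
    by (elim disjE) (rule exI[of _ 0] exI[of _ "-3"] exI[of _ "-45"], simp)+
  then show ?thesis
    unfolding zmod_int of_nat_numeral by (elim exE) (rule mod_shift)
qed

lemma wrap_residue: "(int j - 4) mod 48 = int ((j + 44) mod 48)"
  unfolding zmod_int of_nat_numeral by (rule mod_shift[of _ _ _ "-1"]) simp

lemma forward_simps [simp]: "Ring \<in> forward" "Spoke \<in> forward" "Ring' \<notin> forward" "Spoke' \<notin> forward"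
  by (auto simp: forward_def)

lemma D_vtx: "D = {(vtx t, vtx (go l t)) | t l. l \<in> forward}"
proof (intro equalityI subsetI)
  fix e assume "e \<in> D"
  then obtain u v k where e: "e = ((u, k), (v, (k + 1) mod p))"
    and uv: "(u, v) \<in> Y_orientation 4 48 13 44" and k: "k < p"
    by (auto simp: D_def)
  have kk: "(1 + int k) mod int p = int ((k + 1) mod p)" by (simp add: zmod_int)
  consider i j where "u = (i, j)" "v = (i, (j + 13 ^ i) mod 48)" "i < 4" "j < 48"
    | i j where "u = (i, j)" "v = (i + 1, j)" "i < 3" "j < 48"
    | j where "u = (3, j)" "v = (0, (j + 44) mod 48)" "j < 48"
    using uv by (auto simp: Y_orientation_def)
  then show "e \<in> {(vtx t, vtx (go l t)) | t l. l \<in> forward}"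
  proof cases
    case 1
    have "e = (vtx (rep (u, k)), vtx (go Ring (rep (u, k))))"
      using 1 k by (simp add: e vtx.simps rep.simps kk add_ac ring_residue)
    then show ?thesis using forward_simps by blast
  next
    case 2
    have "(1 + int i) mod 4 = int (Suc i)" using 2 by auto
    then have "e = (vtx (rep (u, k)), vtx (go Spoke (rep (u, k))))"
      using 2 k by (simp add: e vtx.simps rep.simps kk add_ac)
    then show ?thesis using forward_simps by blast
  next
    case 3
    have "e = (vtx (rep (u, k)), vtx (go Spoke (rep (u, k))))"
      using 3 k by (simp add: e vtx.simps rep.simps kk add_ac wrap_residue)
    then show ?thesis using forward_simps by blast
  qed
next
  fix e assume "e \<in> {(vtx t, vtx (go l t)) | t l. l \<in> forward}"
  then obtain t l where e: "e = (vtx t, vtx (go l t))" and l: "l \<in> forward" by auto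
  obtain i j k where v: "vtx t = ((i, j), k)" by (cases "vtx t") auto
  have b: "i < 4" "j < 48" "k < p" using vtx_in_V[of t] by (auto simp: v V_eq_Times)
  have r: "vtx (go l t) = vtx (go l (int i, int j - int i, int k))"
    by (rule vtx_go_cong) (metis v vtx_rep vtx_in_V rep.simps)
  have kk: "(1 + int k) mod int p = int ((k + 1) mod p)" by (simp add: zmod_int)
  have "((i, j), fst (vtx (go l t))) \<in> Y_orientation 4 48 13 44 \<and> snd (vtx (go l t)) = (k + 1) mod p"
  proof (cases "l = Ring")
    case True
    then have "vtx (go l t) = ((i, (j + 13 ^ i) mod 48), (k + 1) mod p)"
      using b unfolding r by (simp add: True vtx.simps kk add_ac ring_residue)
    then show ?thesis using b by (auto simp: Y_orientation_def)
  next
    case False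
    then have l: "l = Spoke" using l by (simp add: forward_def)
    show ?thesis
    proof (cases "i = 3")
      case True
      then have "vtx (go l t) = ((0, (j + 44) mod 48), (k + 1) mod p)"
        using b True unfolding r by (simp add: l vtx.simps kk add_ac wrap_residue)
      then show ?thesis using b True by (auto simp: Y_orientation_def)
    next
      case False
      then have "(1 + int i) mod 4 = int (Suc i)" using b by auto
      then have "vtx (go l t) = ((Suc i, j), (k + 1) mod p)"
        using b unfolding r by (simp add: l vtx.simps kk add_ac)
      then show ?thesis using b False by (auto simp: Y_orientation_def)
    qed
  qed
  then show "e \<in> D"
    using b unfolding e D_def v by (cases "vtx (go l t)") auto
qed

lemma D_act: "(u, v) \<in> D \<longleftrightarrow> u \<in> V \<and> (\<exists>l \<in> forward. v = act l u)"
proof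
  assume "(u, v) \<in> D"
  then obtain t l where "u = vtx t" "v = vtx (go l t)" "l \<in> forward" unfolding D_vtx by blast
  then show "u \<in> V \<and> (\<exists>l \<in> forward. v = act l u)" using vtx_in_V act_vtx by metis
next
  assume "u \<in> V \<and> (\<exists>l \<in> forward. v = act l u)"
  then obtain t l where "u = vtx t" "v = act l u" "l \<in> forward" using V_cases by metis
  then show "(u, v) \<in> D" unfolding D_vtx using act_vtx by blast
qed

lemma arcs_act: "(u, v) \<in> parcs G \<longleftrightarrow> u \<in> V \<and> (\<exists>l. v = act l u)"
proof
  assume "(u, v) \<in> parcs G"
  then consider "(u, v) \<in> D" | "(v, u) \<in> D" unfolding arcs_G by auto
  then show "u \<in> V \<and> (\<exists>l. v = act l u)"
    by cases (unfold D_act, metis, metis act_inv(1) act_in_V)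
next
  assume "u \<in> V \<and> (\<exists>l. v = act l u)"
  then obtain l where l: "u \<in> V" "v = act l u" by auto
  show "(u, v) \<in> parcs G"
  proof (cases "l \<in> forward")
    case True
    then show ?thesis using l unfolding arcs_G by (auto simp: D_act)
  next
    case False
    then have "(v, u) \<in> D"
      using l inv_letter_forward act_inv(1) unfolding D_act by (metis act_in_V)
    then show ?thesis unfolding arcs_G by auto
  qed
qed

end

section \<open>Short closed walks\<close>

text \<open>A word is recorded by its two exponent sums \<open>x\<close>, \<open>y\<close> and by the area \<open>r\<close> that the lattice
  path spelled by it cuts off: every \<open>Ring\<close> step picks up the current \<open>y\<close>, because moving it past
  one \<open>Spoke\<close> costs one commutator.\<close>

fun track :: "letter \<Rightarrow> int \<times> int \<times> int \<Rightarrow> int \<times> int \<times> int" where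
  "track Ring (x, y, r) = (x + 1, y, r + y)"
| "track Spoke (x, y, r) = (x, y + 1, r)"
| "track Ring' (x, y, r) = (x - 1, y, r - y)"
| "track Spoke' (x, y, r) = (x, y - 1, r)"

fun place :: "int \<times> int \<times> int \<Rightarrow> int \<times> int \<times> int \<Rightarrow> int \<times> int \<times> int" where
  "place (i, m, k) (x, y, r) = (i + y, m + x * (1 + 12 * i) - y + 12 * r, k + x + y)"

fun trivial :: "int \<times> int \<times> int \<Rightarrow> bool" where
  "trivial (x, y, r) \<longleftrightarrow> x = 0 \<and> y = 0 \<and> 4 dvd r"

fun extent :: "int \<times> int \<times> int \<Rightarrow> int" where
  "extent (x, y, r) = \<bar>x\<bar> + \<bar>y\<bar>"

lemma place_origin [simp]: "place t (0, 0, 0) = t"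
  by (cases t) simp

lemma go_place: "go l (place t s) = place t (track l s)"
  by (cases l; cases t; cases s) (simp_all add: algebra_simps)

lemma extent_track: "extent (track l s) \<le> extent s + 1"
  by (cases l; cases s) auto

text \<open>The last letter \<open>l0\<close> of the closed word is prescribed because, together with the first letter, it
  determines the path of length 2 through the base vertex for which closed walks are counted.\<close>

fun returns :: "letter \<Rightarrow> nat \<Rightarrow> letter \<Rightarrow> int \<times> int \<times> int \<Rightarrow> nat" where
  "returns l0 0 l s = (if l = l0 \<and> trivial s then 1 else 0)"
| "returns l0 (Suc n) l s =
     (\<Sum>m\<leftarrow>[Ring, Spoke, Ring', Spoke']. if m = inv_letter l then 0 else returns l0 n m (track m s))"

lemma returns_8:
  assumes "m \<noteq> inv_letter l"
  shows "returns l 7 m (track m (0, 0, 0)) = (if m = l then 4 else 8)"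
proof -
  have "\<forall>l \<in> {Ring, Spoke, Ring', Spoke'}. \<forall>m \<in> {Ring, Spoke, Ring', Spoke'}.
    m \<noteq> inv_letter l \<longrightarrow> returns l 7 m (track m (0, 0, 0)) = (if m = l then 4 else 8)"
    by code_simp
  then show ?thesis using assms UNIV_letter by blast
qed

definition perp :: "letter \<Rightarrow> letter \<Rightarrow> bool" where
  "perp l m \<longleftrightarrow> m \<noteq> l \<and> m \<noteq> inv_letter l"

lemma perp_sym: "perp l m \<Longrightarrow> perp m l"
  by (auto simp: perp_def)

lemma perp_inv [simp]: "perp (inv_letter l) m = perp l m" "perp l (inv_letter m) = perp l m"
  by (cases l; cases m; simp add: perp_def)+

lemma square_word: "perp l m \<Longrightarrow>
    trivial (fold track [l, l, m, m, inv_letter l, inv_letter l, inv_letter m, inv_letter m] (0, 0, 0))"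
  by (cases l; cases m) (simp_all add: perp_def)

text \<open>A closed word made of four straight pairs, each perpendicular to the next, can only go around a square.\<close>

lemma square_forced:
  assumes "trivial (fold track [a, a, b, b, c, c, d, d] (0, 0, 0))" "perp a b" "perp b c" "perp c d"
  shows "c = inv_letter a"
  using assms by (cases a; cases b; simp add: perp_def; cases c; simp; cases d; simp)

text \<open>The commutator of \<open>l m\<close> and \<open>m l\<close>: its path is a figure of eight with total area 0.\<close>

lemma bent_word: "perp l m \<Longrightarrow>
    trivial (fold track [l, m, m, l, inv_letter m, inv_letter l, inv_letter l, inv_letter m] (0, 0, 0))"
  by (cases l; cases m) (simp_all add: perp_def)

lemma bent_forced:
  assumes "trivial (fold track [a, b, b, a, c, d, d, e] (0, 0, 0))"
    "perp a b" "perp a c" "perp c d" "perp d e"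
  shows "c = inv_letter b"
  using assms by (cases a; cases b; simp add: perp_def; cases c; simp; cases d; simp; cases e; simp)

text \<open>The graph-theoretic counterpart of \<open>returns\<close>: walks from the arc \<open>(u, v)\<close> to the arc \<open>(x, y)\<close>. As it
  mentions adjacency only, the count is invariant under automorphisms.\<close>

fun nonbacktracking :: "'a pair_pre_digraph \<Rightarrow> nat \<Rightarrow> 'a \<Rightarrow> 'a \<Rightarrow> 'a \<Rightarrow> 'a \<Rightarrow> nat" where
  "nonbacktracking H 0 u v x y = (if u = x \<and> v = y then 1 else 0)"
| "nonbacktracking H (Suc n) u v x y = (\<Sum>w \<in> {w. (v, w) \<in> parcs H} - {u}. nonbacktracking H n v w x y)"

lemma nonbacktracking_automorphism:
  assumes f: "f \<in> automorphisms H" and wf: "parcs H \<subseteq> pverts H \<times> pverts H"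
    and xy: "x \<in> pverts H" "y \<in> pverts H"
  shows "u \<in> pverts H \<Longrightarrow> v \<in> pverts H \<Longrightarrow> nonbacktracking H n (f u) (f v) (f x) (f y) = nonbacktracking H n u v x y"
proof (induction n arbitrary: u v)
  case 0
  have "inj f" using f by (auto simp: automorphisms_def permutes_inj)
  then show ?case by (auto dest: injD)
next
  case (Suc n)
  have per: "f permutes pverts H" using f by (auto simp: automorphisms_def)
  then have inj: "inj f" by (rule permutes_inj)
  have "{w. (f v, w) \<in> parcs H} = f ` {w. (v, w) \<in> parcs H}"
  proof (intro equalityI subsetI)
    fix w assume w: "w \<in> {w. (f v, w) \<in> parcs H}"
    then obtain w' where "w' \<in> pverts H" "w = f w'"
      using wf permutes_image[OF per] by blast
    then show "w \<in> f ` {w. (v, w) \<in> parcs H}"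
      using w f Suc.prems by (auto simp: automorphisms_def)
  next
    fix w assume "w \<in> f ` {w. (v, w) \<in> parcs H}"
    then show "w \<in> {w. (f v, w) \<in> parcs H}"
      using f Suc.prems wf by (auto simp: automorphisms_def)
  qed
  then have "{w. (f v, w) \<in> parcs H} - {f u} = f ` ({w. (v, w) \<in> parcs H} - {u})"
    using inj by (auto dest: injD)
  then have "nonbacktracking H (Suc n) (f u) (f v) (f x) (f y)
      = (\<Sum>w \<in> {w. (v, w) \<in> parcs H} - {u}. nonbacktracking H n (f v) (f w) (f x) (f y))"
    by (simp add: sum.reindex[OF inj_on_subset[OF inj subset_UNIV]])
  also have "\<dots> = nonbacktracking H (Suc n) u v x y"
    using Suc wf by (auto intro!: sum.cong)
  finally show ?case .
qed

context voltage_prime begin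

text \<open>Being closed forces \<open>y\<close> to be divisible by 4 and \<open>x - y\<close> by 12, so with \<open>x = 4 a\<close>, \<open>y = 4 b\<close> the
  bound leaves \<open>\<bar>a\<bar> + \<bar>b\<bar> \<le> 2\<close>. As \<open>p\<close> is at least 5, it can divide
  \<open>4 (a + b)\<close> only if \<open>b = - a\<close>, and then 3 divides \<open>2 a\<close>.\<close>

lemma vtx_place_eq:
  assumes "extent s \<le> 8" shows "vtx (place t s) = vtx t \<longleftrightarrow> trivial s"
proof -
  obtain i m k x y r where t: "t = (i, m, k)" "s = (x, y, r)" by (cases t; cases s)
  have iff: "vtx (place t s) = vtx t \<longleftrightarrow> 4 dvd y \<and> 48 dvd x * (1 + 12 * i) - y + 12 * r \<and> int p dvd x + y"
    unfolding t place.simps vtx_eq_iff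
    using dvd_minus_iff[of 48 "x * (1 + 12 * i) - y + 12 * r"] dvd_minus_iff[of "int p" "x + y"]
    by (simp add: algebra_simps)
  show ?thesis
  proof
    assume "vtx (place t s) = vtx t"
    then have d: "4 dvd y" "48 dvd x * (1 + 12 * i) - y + 12 * r" "int p dvd x + y"
      unfolding iff by auto
    obtain b c where b: "y = 4 * b" and c: "x * (1 + 12 * i) - y + 12 * r = 48 * c"
      using d(1,2) by (metis dvdE)
    have x: "x = 4 * (b - 3 * x * i - 3 * r + 12 * c)"
      using b c by (simp add: algebra_simps)
    define a where "a = b - 3 * x * i - 3 * r + 12 * c"
    have a: "x = 4 * a" using x by (simp add: a_def)
    have "int p dvd 4 * (a + b)" using d(3) a b by (simp add: algebra_simps)
    then have "int p dvd a + b"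
      using coprime_4 coprime_dvd_mult_right_iff by blast
    moreover have small: "\<bar>a\<bar> + \<bar>b\<bar> \<le> 2"
      using assms by (simp add: t a b)
    ultimately have ab: "b = - a"
      using small_multiple[of "a + b"] by linarith
    have "2 * a = 3 * (4 * c - x * i - r)"
      using a_def ab by (simp add: algebra_simps)
    then have "3 dvd 2 * a" by simp
    then have "a = 0" using small ab by presburger
    then have "x = 0" "y = 0" using a b ab by auto
    moreover have "4 dvd r" using c calculation by auto
    ultimately show "trivial s" by (simp add: t)
  next
    assume "trivial s"
    then show "vtx (place t s) = vtx t" unfolding iff by (auto simp: t)
  qed
qed

lemma wf_G: "parcs G \<subseteq> V \<times> V"
  by (auto simp: arcs_act)

lemma neighbours: "v \<in> V \<Longrightarrow> {w. (v, w) \<in> parcs G} = (\<lambda>l. act l v) ` {Ring, Spoke, Ring', Spoke'}"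
  unfolding UNIV_letter[symmetric] by (auto simp: arcs_act)

lemma nonbacktracking_returns:
  "extent s + int n \<le> 8 \<Longrightarrow>
   nonbacktracking G n (act (inv_letter l) (vtx (place t s))) (vtx (place t s)) (act (inv_letter l0) (vtx t)) (vtx t)
   = returns l0 n l s"
proof (induction n arbitrary: l s)
  case 0
  then have "vtx (place t s) = vtx t \<longleftrightarrow> trivial s" by (intro vtx_place_eq) simp
  moreover have "act (inv_letter l) (vtx t) = act (inv_letter l0) (vtx t) \<longleftrightarrow> l = l0"
    using act_inject[OF vtx_in_V] inv_letter_inject by metis
  ultimately show ?case by (auto simp del: act_vtx)
next
  case (Suc n)
  let ?x = "vtx (place t s)"
  let ?t = "\<lambda>m. nonbacktracking G n ?x (act m ?x) (act (inv_letter l0) (vtx t)) (vtx t)"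
  have IH: "?t m = returns l0 n m (track m s)" for m
    using Suc.IH[of "track m s" m] Suc.prems extent_track[of m s] by (simp add: go_place[symmetric])
  have inj: "inj_on (\<lambda>l. act l ?x) L" for L
    using act_inject[of ?x] by (auto simp: inj_on_def simp del: act_vtx)
  have "{w. (?x, w) \<in> parcs G} - {act (inv_letter l) ?x}
      = (\<lambda>m. act m ?x) ` ({Ring, Spoke, Ring', Spoke'} - {inv_letter l})"
    using act_inject[of ?x] by (subst neighbours) (auto simp del: act_vtx)
  then have "nonbacktracking G (Suc n) (act (inv_letter l) ?x) ?x (act (inv_letter l0) (vtx t)) (vtx t)
      = (\<Sum>m \<in> {Ring, Spoke, Ring', Spoke'} - {inv_letter l}. ?t m)"
    by (simp add: sum.reindex[OF inj] del: act_vtx)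
  also have "\<dots> = (\<Sum>m \<in> {Ring, Spoke, Ring', Spoke'} - {inv_letter l}. returns l0 n m (track m s))"
    using IH by simp
  also have "\<dots> = returns l0 (Suc n) l s"
    by (cases l) (simp_all add: insert_Diff_if)
  finally show ?case .
qed

text \<open>The count that makes straight paths recognizable: 4 closed 8-walks pass through a straight path
  of length 2, and 8 through any other.\<close>

lemma closed_8_walks:
  assumes "v \<in> V" "m \<noteq> inv_letter l"
  shows "nonbacktracking G 7 v (act m v) (act (inv_letter l) v) v = (if m = l then 4 else 8)"
proof -
  have "extent (track m (0, 0, 0)) + int 7 \<le> 8" by (cases m) auto
  from nonbacktracking_returns[OF this, of m "rep v" l]
  have "nonbacktracking G 7 v (act m v) (act (inv_letter l) v) v = returns l 7 m (track m (0, 0, 0))"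
    using assms(1) by (simp add: go_place[symmetric] act_vtx[symmetric] del: act_vtx)
  then show ?thesis using returns_8[OF assms(2)] by simp
qed

fun walk :: "letter list \<Rightarrow> (nat \<times> nat) \<times> nat \<Rightarrow> (nat \<times> nat) \<times> nat" where
  "walk [] v = v"
| "walk (l # ls) v = walk ls (act l v)"

lemma walk_place: "walk ls (vtx (place t s)) = vtx (place t (fold track ls s))"
  by (induction ls arbitrary: s) (simp_all add: go_place)

lemma extent_fold: "extent (fold track ls s) \<le> extent s + int (length ls)"
proof (induction ls arbitrary: s)
  case (Cons l ls)
  show ?case using Cons[of "track l s"] extent_track[of l s] by simp
qed simp

lemma walk_closed_iff:
  assumes "v \<in> V" "length ls \<le> 8"
  shows "walk ls v = v \<longleftrightarrow> trivial (fold track ls (0, 0, 0))"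
proof -
  have "extent (fold track ls (0, 0, 0)) \<le> 8"
    using extent_fold[of ls "(0, 0, 0)"] assms(2) by simp
  from vtx_place_eq[OF this, of "rep v"] show ?thesis
    using walk_place[of ls "rep v" "(0, 0, 0)"] assms(1) by simp
qed

section \<open>Automorphisms relabel directions uniformly\<close>

definition relabel :: "((nat \<times> nat) \<times> nat \<Rightarrow> (nat \<times> nat) \<times> nat) \<Rightarrow> (nat \<times> nat) \<times> nat \<Rightarrow> letter \<Rightarrow> letter" where
  "relabel f v l = (THE l'. f (act l v) = act l' (f v))"

context
  fixes f assumes f: "f \<in> automorphisms G"
begin

lemma aut_in_V: "v \<in> V \<Longrightarrow> f v \<in> V"
  using f by (auto simp: automorphisms_def permutes_in_image)

lemma aut_inj: "inj f"
  using f by (auto simp: automorphisms_def permutes_inj)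

lemma relabel_eqI:
  assumes "v \<in> V" "f (act l v) = act l' (f v)" shows "relabel f v l = l'"
  unfolding relabel_def using assms aut_in_V act_inject by (intro the_equality) metis+

lemma aut_act:
  assumes "v \<in> V" shows "f (act l v) = act (relabel f v l) (f v)"
proof -
  have "(v, act l v) \<in> parcs G" using assms by (auto simp: arcs_act)
  then have "(f v, f (act l v)) \<in> parcs G" using f assms by (auto simp: automorphisms_def)
  then obtain l' where "f (act l v) = act l' (f v)" by (auto simp: arcs_act)
  then show ?thesis using relabel_eqI assms by metis
qed

lemma relabel_inject:
  assumes "v \<in> V" "relabel f v l = relabel f v m" shows "l = m"
  using assms aut_act aut_inj act_inject by (metis injD)

lemma relabel_back:
  assumes "v \<in> V" shows "relabel f (act l v) (inv_letter l) = inv_letter (relabel f v l)"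
  using assms aut_act by (intro relabel_eqI) (simp_all add: aut_in_V)

text \<open>The path from \<open>act (inv_letter l) v\<close> through \<open>v\<close> to \<open>act l v\<close> is straight, hence so is its image.\<close>

lemma relabel_inv:
  assumes "v \<in> V" shows "relabel f v (inv_letter l) = inv_letter (relabel f v l)"
proof -
  let ?n = "inv_letter (relabel f v (inv_letter l))"
  have ne: "l \<noteq> inv_letter l" by simp
  have "relabel f v l \<noteq> inv_letter ?n" using relabel_inject[OF assms] ne by fastforce
  then have "nonbacktracking G 7 (f v) (act (relabel f v l) (f v)) (act (inv_letter ?n) (f v)) (f v)
      = (if relabel f v l = ?n then 4 else 8)"
    using closed_8_walks aut_in_V[OF assms] by blast
  also have "nonbacktracking G 7 (f v) (act (relabel f v l) (f v)) (act (inv_letter ?n) (f v)) (f v)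
      = nonbacktracking G 7 (f v) (f (act l v)) (f (act (inv_letter l) v)) (f v)"
    using aut_act[OF assms] by simp
  also have "\<dots> = nonbacktracking G 7 v (act l v) (act (inv_letter l) v) v"
    using nonbacktracking_automorphism[OF f wf_G] assms by simp
  also have "\<dots> = 4" using closed_8_walks[OF assms] ne by simp
  finally show ?thesis by (simp split: if_splits) 
qed

lemma relabel_along:
  assumes "v \<in> V" shows "relabel f (act l v) l = relabel f v l"
  using relabel_back[OF assms, of l] relabel_inv[of "act l v" l] by simp

lemma relabel_perp: 
  assumes "v \<in> V" "perp l m" shows "perp (relabel f v l) (relabel f v m)"
  using assms relabel_inject relabel_inv unfolding perp_def by metis

text \<open>The closed walk around a square with sides of length 2 is straight at every other vertex, so its image
  is again made of straight pairs. The image is closed, so it is a square as well, and opposite sides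
  of a square have the same direction.\<close>

lemma relabel_square:
  assumes v: "v \<in> V" and lm: "perp l m"
  shows "relabel f (act m (act m v)) l = relabel f v l"
proof -
  define v0 where "v0 = act (inv_letter l) (act (inv_letter l) v)"
  define v1 where "v1 = act l v0"
  define v3 where "v3 = act m v"
  define v4 where "v4 = act m v3"
  define v5 where "v5 = act (inv_letter l) v4"
  define v6 where "v6 = act (inv_letter l) v5"
  define v7 where "v7 = act (inv_letter m) v6"
  have V: "v0 \<in> V" "v1 \<in> V" "v3 \<in> V" "v4 \<in> V" "v5 \<in> V" "v6 \<in> V" "v7 \<in> V"
    by (simp_all add: v0_def v1_def v3_def v4_def v5_def v6_def v7_def)
  have v2: "v = act l v1" using v by (simp add: v1_def v0_def)
  have "walk [l, l, m, m, inv_letter l, inv_letter l, inv_letter m, inv_letter m] v0 = v0"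
    by (rule iffD2[OF walk_closed_iff[OF V(1)] square_word[OF lm]]) simp
  then have closed: "act (inv_letter m) v7 = v0"
    by (simp add: v1_def[symmetric] v2[symmetric] v3_def[symmetric] v4_def[symmetric]
        v5_def[symmetric] v6_def[symmetric] v7_def[symmetric])
  have steps: "f v1 = act (relabel f v l) (f v0)" "f v = act (relabel f v l) (f v1)"
    "f v3 = act (relabel f v m) (f v)" "f v4 = act (relabel f v m) (f v3)"
    "f v5 = act (relabel f v4 (inv_letter l)) (f v4)" "f v6 = act (relabel f v4 (inv_letter l)) (f v5)"
    "f v7 = act (relabel f v6 (inv_letter m)) (f v6)" "f v0 = act (relabel f v6 (inv_letter m)) (f v7)"
    using V v aut_act relabel_along v2 v1_def v3_def v4_def v5_def v6_def v7_def closed by metis+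
  have "walk [relabel f v l, relabel f v l, relabel f v m, relabel f v m, relabel f v4 (inv_letter l),
      relabel f v4 (inv_letter l), relabel f v6 (inv_letter m), relabel f v6 (inv_letter m)] (f v0) = f v0"
    by (simp add: steps[symmetric])
  then have triv: "trivial (fold track [relabel f v l, relabel f v l, relabel f v m, relabel f v m, relabel f v4 (inv_letter l),
      relabel f v4 (inv_letter l), relabel f v6 (inv_letter m), relabel f v6 (inv_letter m)] (0, 0, 0))"
    by (subst (asm) walk_closed_iff) (simp_all add: aut_in_V V)
  have "relabel f v m = relabel f v4 m"
    using V v relabel_along v3_def v4_def by metis
  moreover have "relabel f v4 (inv_letter l) = relabel f v6 (inv_letter l)"
    using V relabel_along v5_def v6_def by metis
  ultimately have "relabel f v4 (inv_letter l) = inv_letter (relabel f v l)"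
    using relabel_perp[OF v lm] relabel_perp[OF V(4), of m "inv_letter l"]
      relabel_perp[OF V(6), of "inv_letter l" "inv_letter m"] lm perp_sym[OF lm]
    by (intro square_forced[OF triv]) simp_all
  then show ?thesis
    using relabel_inv[OF V(4), of l] by (simp add: v3_def v4_def)
qed

text \<open>Along the direction of the step, and against it, this is \<open>relabel_along\<close> and \<open>relabel_back\<close>. For a
  perpendicular direction \<open>m\<close>, the image of the closed walk \<open>l m m l m' l' l' m'\<close> (primes denote inverses) is
  known by \<open>relabel_square\<close> up to the fifth letter, where closedness leaves no choice either.\<close>

lemma relabel_step:
  assumes v: "v \<in> V" shows "relabel f (act l v) = relabel f v"
proof -
  have across: "relabel f (act l v) m = relabel f v m" if lm: "perp l m" for m
  proof -
    define v2 where "v2 = act (inv_letter m) v"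
    define v1 where "v1 = act (inv_letter m) v2"
    define v0 where "v0 = act (inv_letter l) v1"
    define v4 where "v4 = act l v"
    define v5 where "v5 = act (inv_letter m) v4"
    define v6 where "v6 = act (inv_letter l) v5"
    define v7 where "v7 = act (inv_letter l) v6"
    have V: "v0 \<in> V" "v1 \<in> V" "v2 \<in> V" "v4 \<in> V" "v5 \<in> V" "v6 \<in> V" "v7 \<in> V"
      by (simp_all add: v0_def v1_def v2_def v4_def v5_def v6_def v7_def)
    have r: "v1 = act l v0" "v2 = act m v1" "v = act m v2"
      using v V by (simp_all add: v0_def v1_def v2_def)
    have "walk [l, m, m, l, inv_letter m, inv_letter l, inv_letter l, inv_letter m] v0 = v0"
      by (rule iffD2[OF walk_closed_iff[OF V(1)] bent_word[OF lm]]) simp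
    then have closed: "act (inv_letter m) v7 = v0"
      by (simp add: r[symmetric] v4_def[symmetric] v5_def[symmetric] v6_def[symmetric] v7_def[symmetric])
    have l1: "relabel f v1 l = relabel f v l"
      using relabel_square[OF V(2) lm] r by simp
    have steps: "f v1 = act (relabel f v l) (f v0)" "f v2 = act (relabel f v m) (f v1)"
      "f v = act (relabel f v m) (f v2)" "f v4 = act (relabel f v l) (f v)"
      "f v5 = act (relabel f v4 (inv_letter m)) (f v4)" "f v6 = act (relabel f v5 (inv_letter l)) (f v5)"
      "f v7 = act (relabel f v5 (inv_letter l)) (f v6)" "f v0 = act (relabel f v7 (inv_letter m)) (f v7)"
      using V v aut_act relabel_along l1 r v4_def v5_def v6_def v7_def closed by metis+
    have "walk [relabel f v l, relabel f v m, relabel f v m, relabel f v l, relabel f v4 (inv_letter m),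
        relabel f v5 (inv_letter l), relabel f v5 (inv_letter l), relabel f v7 (inv_letter m)] (f v0) = f v0"
      by (simp add: steps[symmetric])
    then have triv: "trivial (fold track [relabel f v l, relabel f v m, relabel f v m, relabel f v l,
        relabel f v4 (inv_letter m), relabel f v5 (inv_letter l), relabel f v5 (inv_letter l),
        relabel f v7 (inv_letter m)] (0, 0, 0))"
      by (subst (asm) walk_closed_iff) (simp_all add: aut_in_V V)
    have "relabel f v4 l = relabel f v l" using relabel_along[OF v] v4_def by simp
    moreover have "relabel f v5 (inv_letter m) = relabel f v4 (inv_letter m)"
      using V relabel_along v5_def by metis
    moreover have "relabel f v5 (inv_letter l) = relabel f v7 (inv_letter l)"
      using V relabel_along v6_def v7_def by metis
    ultimately have "relabel f v4 (inv_letter m) = inv_letter (relabel f v m)"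
      using relabel_perp[OF v lm] relabel_perp[OF V(4), of l "inv_letter m"]
        relabel_perp[OF V(5), of "inv_letter m" "inv_letter l"]
        relabel_perp[OF V(7), of "inv_letter l" "inv_letter m"] lm perp_sym[OF lm]
      by (intro bent_forced[OF triv]) simp_all
    then show ?thesis
      using relabel_inv[OF V(4), of m] by (simp add: v4_def)
  qed
  show ?thesis
  proof
    fix m show "relabel f (act l v) m = relabel f v m"
      using across[of m] relabel_along[OF v, of l] relabel_back[OF v, of l] relabel_inv[OF v, of l]
      by (cases "perp l m") (auto simp: perp_def)
  qed
qed

text \<open>An automorphism is determined by the image of one vertex and one relabelling of the directions.\<close>

lemma aut_walk:
  assumes "v \<in> V" shows "f (walk ls v) = walk (map (relabel f v) ls) (f v)"
  using assms
proof (induction ls arbitrary: v)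
  case (Cons l ls)
  then show ?case using relabel_step[OF Cons.prems, of l] aut_act[OF Cons.prems, of l] by simp
qed simp

end

end

section \<open>Symmetries of the cover\<close>

context voltage_prime begin

definition induced :: "(int \<times> int \<times> int \<Rightarrow> int \<times> int \<times> int) \<Rightarrow> (nat \<times> nat) \<times> nat \<Rightarrow> (nat \<times> nat) \<times> nat" where
  "induced F v = (if v \<in> V then vtx (F (rep v)) else v)"

text \<open>The maps of coordinate triples that induce an orientation-preserving automorphism of the cover. Only
  preservation of arcs is required, since injectivity and finiteness give the converse.\<close>

definition admissible :: "(int \<times> int \<times> int \<Rightarrow> int \<times> int \<times> int) \<Rightarrow> bool" where
  "admissible F \<longleftrightarrow> (\<forall>t t'. vtx (F t) = vtx (F t') \<longleftrightarrow> vtx t = vtx t') \<and>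
     (\<forall>t. \<forall>l \<in> forward. \<exists>l' \<in> forward. vtx (F (go l t)) = vtx (go l' (F t)))"

lemma induced_vtx:
  assumes "admissible F" shows "induced F (vtx t) = vtx (F t)"
proof -
  have "vtx (rep (vtx t)) = vtx t" by simp
  then have "vtx (F (rep (vtx t))) = vtx (F t)" using assms unfolding admissible_def by blast
  then show ?thesis by (simp add: induced_def)
qed

lemma induced_D:
  assumes F: "admissible F" and uv: "(u, v) \<in> D" shows "(induced F u, induced F v) \<in> D"
proof -
  obtain t l where t: "u = vtx t" "v = vtx (go l t)" "l \<in> forward"
    using uv unfolding D_vtx by blast
  then obtain l' where "l' \<in> forward" "vtx (F (go l t)) = vtx (go l' (F t))"
    using F unfolding admissible_def by blast
  then show ?thesis
    unfolding t induced_vtx[OF F] D_vtx by blast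
qed

lemma finite_arcs_G: "finite (parcs G)"
  using wf_G finite_V by (meson finite_SigmaI finite_subset)

lemma induced_automorphism:
  assumes F: "admissible F" shows "induced F \<in> automorphisms G"
proof -
  have inj: "inj_on (induced F) V"
    using F by (auto simp: inj_on_def V_eq induced_vtx admissible_def)
  have into: "induced F ` V \<subseteq> V"
    by (auto simp: induced_def)
  have "bij_betw (induced F) V V"
    using inj endo_inj_surj[OF finite_V into inj] by (simp add: bij_betw_def)
  then have per: "induced F permutes V"
    by (rule bij_imp_permutes) (simp add: induced_def)
  let ?g = "map_prod (induced F) (induced F)"
  have arcs: "?g ` parcs G \<subseteq> parcs G"
    using induced_D[OF F] by (auto simp: arcs_G)
  have "inj_on ?g (parcs G)"
    using permutes_inj[OF per] by (auto simp: inj_on_def dest: injD)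
  then have "?g ` parcs G = parcs G"
    using arcs finite_arcs_G by (intro endo_inj_surj)
  moreover have "inj ?g"
    using permutes_inj[OF per] prod.inj_map by blast
  ultimately have "?g e \<in> parcs G \<longleftrightarrow> e \<in> parcs G" for e
    by (metis inj_image_mem_iff)
  from this[of "(u, v)" for u v] show ?thesis
    using per by (auto simp: automorphisms_def)
qed

text \<open>\<open>shift\<close> is left multiplication in the group behind the Cayley graph, and \<open>exchange\<close> is the group
  automorphism that exchanges the two generators.\<close>

fun shift :: "int \<Rightarrow> int \<Rightarrow> int \<Rightarrow> int \<times> int \<times> int \<Rightarrow> int \<times> int \<times> int" where
  "shift c s h (i, m, k) = (i + c, (1 + 12 * c) * m + 12 * c * i + s, k + h)"

fun exchange :: "int \<times> int \<times> int \<Rightarrow> int \<times> int \<times> int" where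
  "exchange (i, m, k) = (m + i, - m + 12 * i * (m + i), k)"

lemma shift_go: "vtx (shift c s h (go l t)) = vtx (go l (shift c s h t))"
proof (cases t)
  case (fields i m k)
  have "48 dvd 144 * c * i" by (simp add: dvd_mult2)
  then show ?thesis
    unfolding fields by (cases l) (simp_all add: vtx_eq_iff algebra_simps)
qed

text \<open>Modulo 48 the factor \<open>1 + 12 c\<close> has the inverse \<open>1 - 12 c\<close>.\<close>

lemma shift_admissible: "admissible (shift c s h)"
  unfolding admissible_def
proof (intro conjI allI ballI)
  fix t t' :: "int \<times> int \<times> int"
  obtain i m k i' m' k' where t: "t = (i, m, k)" "t' = (i', m', k')" by (cases t; cases t')
  show "vtx (shift c s h t) = vtx (shift c s h t') \<longleftrightarrow> vtx t = vtx t'"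
  proof -
    have "48 dvd m' - m \<longleftrightarrow> 48 dvd (1 + 12 * c) * (m' - m) + 12 * c * (i' - i)" if "4 dvd i' - i"
    proof -
      obtain x where x: "i' - i = 4 * x" using \<open>4 dvd i' - i\<close> by blast
      have "m' - m = (1 - 12 * c) * ((1 + 12 * c) * (m' - m) + 12 * c * (i' - i))
          + 48 * (3 * c * c * (m' - m) - c * x * (1 - 12 * c))"
        unfolding x by (simp add: algebra_simps)
      then have "48 dvd m' - m" if "48 dvd (1 + 12 * c) * (m' - m) + 12 * c * (i' - i)"
        using that by (metis dvd_add dvd_mult dvd_triv_left)
      moreover have "(1 + 12 * c) * (m' - m) + 12 * c * (i' - i) = (1 + 12 * c) * (m' - m) + 48 * (c * x)"
        by (simp add: x)
      ultimately show ?thesis by (metis dvd_add dvd_mult dvd_triv_left)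
    qed
    moreover have "(1 + 12 * c) * (m' - m) + 12 * c * (i' - i)
        = (1 + 12 * c) * m' + 12 * c * i' + s - ((1 + 12 * c) * m + 12 * c * i + s)"
      by (simp add: algebra_simps)
    ultimately show ?thesis
      unfolding t shift.simps vtx_eq_iff by auto
  qed
qed (use shift_go in blast)

lemma exchange_go: "vtx (exchange (go Ring t)) = vtx (go Spoke (exchange t))" "vtx (exchange (go Spoke t)) = vtx (go Ring (exchange t))"
proof -
  obtain i m k where t: "t = (i, m, k)" by (cases t)
  have "48 dvd 144 * i * i" by (simp add: dvd_mult2)
  then show "vtx (exchange (go Ring t)) = vtx (go Spoke (exchange t))" "vtx (exchange (go Spoke t)) = vtx (go Ring (exchange t))"
    unfolding t by (simp_all add: vtx_eq_iff algebra_simps)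
qed

lemma exchange_admissible: "admissible exchange"
  unfolding admissible_def
proof (intro conjI allI ballI)
  fix t t' :: "int \<times> int \<times> int"
  obtain i m k i' m' k' where t: "t = (i, m, k)" "t' = (i', m', k')" by (cases t; cases t')
  show "vtx (exchange t) = vtx (exchange t') \<longleftrightarrow> vtx t = vtx t'"
  proof -
    let ?e = "(- m' + 12 * i' * (m' + i')) - (- m + 12 * i * (m + i))"
    have "4 dvd i' - i \<and> 48 dvd m' - m" if a: "4 dvd (m' + i') - (m + i)" "48 dvd ?e"
    proof -
      obtain x y where x: "(m' + i') - (m + i) = 4 * x" and y: "?e = 48 * y"
        using a by (metis dvdE)
      have "?e = - (m' - m) + 12 * (i' - i) * (m + i) + 48 * (i' * x)"
        using x by algebra
      moreover have "m' - m = 4 * x - (i' - i)" using x by simp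
      ultimately have d: "i' - i = 4 * (x - 3 * (i' - i) * (m + i) + 12 * (y - i' * x))"
        using y by algebra
      then obtain z where z: "i' - i = 4 * z" by blast
      have "m' - m = 48 * (z * (m + i) + i' * x - y)"
        using x y z by algebra
      then show ?thesis using z by simp
    qed
    moreover have "4 dvd (m' + i') - (m + i) \<and> 48 dvd ?e" if a: "4 dvd i' - i" "48 dvd m' - m"
    proof -
      obtain x y where x: "i' - i = 4 * x" and y: "m' - m = 48 * y"
        using a by (metis dvdE)
      have "(m' + i') - (m + i) = 4 * (12 * y + x)" using x y by simp
      moreover have "?e = 48 * (x * (m + i) + i' * (12 * y + x) - y)"
        using x y by algebra
      ultimately show ?thesis by simp
    qed
    ultimately show ?thesis
      unfolding t exchange.simps vtx_eq_iff by blast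
  qed
next
  fix t l assume "l \<in> forward"
  then consider "l = Ring" | "l = Spoke" by (auto simp: forward_def)
  then show "\<exists>l' \<in> forward. vtx (exchange (go l t)) = vtx (go l' (exchange t))"
    using exchange_go[of t] forward_simps by cases blast+
qed

lemma automorphisms_comp:
  assumes "f \<in> automorphisms H" "g \<in> automorphisms H" shows "f \<circ> g \<in> automorphisms H"
  using assms permutes_in_image[of _ "pverts H"]
  by (auto simp: automorphisms_def permutes_compose)

lemma shift_exists:
  obtains f where "f \<in> automorphisms G" "f (vtx t) = vtx t'" "\<And>l. f (vtx (go l t)) = vtx (go l t')"
proof -
  obtain i m k i' m' k' where t: "t = (i, m, k)" "t' = (i', m', k')" by (cases t; cases t')
  define c where "c = i' - i"
  let ?F = "shift c (m' - ((1 + 12 * c) * m + 12 * c * i)) (k' - k)"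
  have "?F t = t'" by (simp add: t c_def)
  then show ?thesis
    using that[of "induced ?F"] induced_automorphism[OF shift_admissible] induced_vtx[OF shift_admissible] shift_go
    by metis
qed

lemma D_transitive:
  assumes "(u, v) \<in> D" "(x, y) \<in> D"
  shows "\<exists>f \<in> automorphisms G. f u = x \<and> f v = y"
proof -
  obtain t l where t: "u = vtx t" "v = vtx (go l t)" "l \<in> forward"
    using assms(1) unfolding D_vtx by blast
  obtain t' l' where t': "x = vtx t'" "y = vtx (go l' t')" "l' \<in> forward"
    using assms(2) unfolding D_vtx by blast
  show ?thesis
  proof (cases "l = l'")
    case True
    then show ?thesis using shift_exists[of t t'] t t' by metis
  next
    case False
    then consider "l = Ring" "l' = Spoke" | "l = Spoke" "l' = Ring"
      using t(3) t'(3) by (auto simp: forward_def)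
    then have "vtx (exchange (go l t)) = vtx (go l' (exchange t))"
      by cases (simp_all only: exchange_go)
    moreover obtain f where "f \<in> automorphisms G" "f (vtx (exchange t)) = vtx t'"
        "f (vtx (go l' (exchange t))) = vtx (go l' t')"
      using shift_exists[of "exchange t" t'] by metis
    ultimately show ?thesis
      using automorphisms_comp[OF _ induced_automorphism[OF exchange_admissible], of f]
      by (intro bexI[of _ "f \<circ> induced exchange"]) (simp_all add: t t' induced_vtx[OF exchange_admissible])
  qed
qed

lemma D_asym: "(u, v) \<in> D \<Longrightarrow> (v, u) \<notin> D"
proof
  assume "(u, v) \<in> D" "(v, u) \<in> D"
  then obtain l l' where l: "u \<in> V" "v = act l u" "l \<in> forward" and l': "u = act l' v" "l' \<in> forward"
    unfolding D_act by blast
  have "act l' v = act (inv_letter l) v" using l l' act_inv(1) by metis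
  then have "l' = inv_letter l" using act_inject act_in_V l(2) by metis
  then show False using l(3) l'(2) inv_letter_forward by simp
qed

section \<open>No automorphism reverses an arc\<close>

text \<open>For \<open>r = Ring\<close> and \<open>s = Spoke\<close> the net effect of this word is to add 4 to \<open>k\<close>: the 8 rings and the
  4 inverse spokes add 12 to \<open>m\<close>, and the ring traversed one spoke lower contributes the
  compensating commutator \<open>- 12\<close>.\<close>

definition drift :: "letter \<Rightarrow> letter \<Rightarrow> letter list" where
  "drift r s = replicate 7 r @ [inv_letter s, r] @ replicate 3 (inv_letter s)"

lemma walk_go: "walk ls (vtx t) = vtx (fold go ls t)"
  by (induction ls arbitrary: t) simp_all

text \<open>Exactly the two relabellings that preserve the orientation keep the displacement \<open>c\<close> divisible by 48;
  for the other six it is 16 or 32, 8 or 40, or 24 modulo 48.\<close>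

lemma drift_walk:
  assumes "perp r s" "fold go (drift r s) (0, 0, 0) = (x, c, d)"
  shows "walk (drift r s) (vtx (i, m, k)) = vtx (i, m + c, k + d)"
    "48 dvd c \<longleftrightarrow> r \<in> forward \<and> s \<in> forward"
proof -
  show "walk (drift r s) (vtx (i, m, k)) = vtx (i, m + c, k + d)"
    using assms unfolding walk_go
    by (cases r; cases s; simp add: perp_def drift_def numeral_eq_Suc; auto simp: vtx_eq_iff)
  show "48 dvd c \<longleftrightarrow> r \<in> forward \<and> s \<in> forward"
    using assms
    by (cases r; cases s; simp add: perp_def drift_def numeral_eq_Suc; auto)
qed

lemma walk_append: "walk (xs @ ys) v = walk ys (walk xs v)"
  by (induction xs arbitrary: v) simp_all

lemma drift_iterate:
  assumes "perp r s" "fold go (drift r s) (0, 0, 0) = (x, c, d)"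
  shows "walk (concat (replicate n (drift r s))) (vtx (i, m, k)) = vtx (i, m + int n * c, k + int n * d)"
  by (induction n arbitrary: m k)
    (simp_all add: walk_append drift_walk(1)[OF assms] algebra_simps)

text \<open>The \<open>p\<close>-th power of \<open>drift Ring Spoke\<close> closes up, so the \<open>p\<close>-th power of its relabelling does, and
  its displacement \<open>p c\<close> is divisible by 48. For inverting both generators, \<open>c\<close> is 24
  modulo 48, so it matters that \<open>p\<close> is odd.\<close>

lemma automorphism_D:
  assumes f: "f \<in> automorphisms G" and uv: "(u, v) \<in> D"
  shows "(f u, f v) \<in> D"
proof -
  obtain l where u: "u \<in> V" and v: "v = act l u" "l \<in> forward"
    using uv unfolding D_act by blast
  define r s where "r = relabel f u Ring" and "s = relabel f u Spoke"
  have rs: "perp r s" unfolding r_def s_def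
    by (rule relabel_perp[OF f u]) (simp add: perp_def)
  let ?w = "\<lambda>r s. concat (replicate p (drift r s))"
  obtain i m k where t: "u = vtx (i, m, k)" using u by (metis V_cases prod_cases3)
  obtain i' m' k' where t': "f u = vtx (i', m', k')"
    using aut_in_V[OF f u] by (metis V_cases prod_cases3)
  obtain x c d where xcd: "fold go (drift r s) (0, 0, 0) = (x, c, d)" by (metis prod_cases3)
  have "walk (?w Ring Spoke) u = vtx (i, m + int p * 0, k + int p * 4)"
    unfolding t by (rule drift_iterate) (simp_all add: perp_def drift_def numeral_eq_Suc)
  also have "\<dots> = u" by (simp add: t vtx_eq_iff)
  finally have "f u = walk (map (relabel f u) (?w Ring Spoke)) (f u)"
    using aut_walk[OF f u] by metis
  also have "map (relabel f u) (?w Ring Spoke) = ?w r s"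
    using relabel_inv[OF f u, of Spoke] by (simp add: map_concat drift_def r_def s_def)
  also have "walk (?w r s) (f u) = vtx (i', m' + int p * c, k' + int p * d)"
    unfolding t' by (rule drift_iterate[OF rs xcd])
  finally have "48 dvd int p * c"
    unfolding t' vtx_eq_iff by simp
  then have "48 dvd c"
    using coprime_48 by (simp add: coprime_commute coprime_dvd_mult_right_iff)
  then have "r \<in> forward" "s \<in> forward"
    using drift_walk(2)[OF rs xcd] by auto
  then have "relabel f u l \<in> forward" using v(2) by (auto simp: forward_def r_def s_def)
  then show ?thesis
    using aut_act[OF f u, of l] aut_in_V[OF f u] unfolding D_act v(1) by blast
qed

section \<open>Connectedness and half-arc-transitivity\<close>

lemma D_step: "l \<in> forward \<Longrightarrow> (vtx t, vtx (go l t)) \<in> D"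
  unfolding D_vtx by blast

lemma half_arc_transitive_G: "half_arc_transitive G"
  unfolding half_arc_transitive_def
proof (intro conjI)
  show "vertex_transitive G"
    unfolding vertex_transitive_def using shift_exists V_cases by metis
  show "edge_transitive G"
    unfolding edge_transitive_def
  proof (clarify)
    fix u v x y assume "(u, v) \<in> parcs G" "(x, y) \<in> parcs G"
    then obtain u' v' x' y' where "{u, v} = {u', v'}" "{x, y} = {x', y'}" "(u', v') \<in> D" "(x', y') \<in> D"
      unfolding arcs_G by blast
    moreover from this obtain f where "f \<in> automorphisms G" "f u' = x'" "f v' = y'"
      using D_transitive by metis
    ultimately have "f \<in> automorphisms G" "{f u, f v} = {x, y}"
      by (metis image_empty image_insert)+
    then show "\<exists>f \<in> automorphisms G. {f u, f v} = {x, y}" by blast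
  qed
  show "\<not> arc_transitive G"
  proof
    assume a: "arc_transitive G"
    have uv: "(vtx (0, 0, 0), vtx (go Ring (0, 0, 0))) \<in> D" by (rule D_step) simp
    let ?u = "vtx (0, 0, 0)" and ?v = "vtx (go Ring (0, 0, 0))"
    have "(?u, ?v) \<in> parcs G" "(?v, ?u) \<in> parcs G" using uv unfolding arcs_G by auto
    then obtain f where "f \<in> automorphisms G" "f ?u = ?v" "f ?v = ?u"
      using a unfolding arc_transitive_def by fast
    then have "(?v, ?u) \<in> D" using automorphism_D[OF _ uv] by metis
    then show False using D_asym[OF uv] by blast
  qed
qed

lemma pair_graph_G: "pair_graph G"
proof
  show "finite V" by (rule finite_V)
  show "finite (parcs G)" by (rule finite_arcs_G)
  show "symmetric (with_proj G)"
    unfolding symmetric_def by (auto simp: sym_def arcs_G)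
  fix e assume e: "e \<in> parcs G"
  then show "fst e \<in> V" "snd e \<in> V" using wf_G by auto
  show "fst e \<noteq> snd e"
  proof
    assume "fst e = snd e"
    then have "(fst e, fst e) \<in> D" using e unfolding arcs_G by (cases e) auto
    then show False using D_asym by blast
  qed
qed

lemma out_degree_4:
  assumes "v \<in> V" shows "out_degree (with_proj G) v = 4"
proof -
  have "out_arcs (with_proj G) v = Pair v ` {w. (v, w) \<in> parcs G}"
    by (auto simp: out_arcs_def)
  also have "\<dots> = (\<lambda>l. (v, act l v)) ` {Ring, Spoke, Ring', Spoke'}"
    unfolding neighbours[OF assms] image_image ..
  finally have "out_degree (with_proj G) v = card ((\<lambda>l. (v, act l v)) ` {Ring, Spoke, Ring', Spoke'})"
    by (simp add: out_degree_def)
  also have "\<dots> = card {Ring, Spoke, Ring', Spoke'}"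
    using act_inject[OF assms] by (intro card_image) (auto simp: inj_on_def)
  finally show ?thesis by simp
qed

text \<open>As 4 is invertible modulo \<open>p\<close>, repeated drift reaches every value of \<open>k\<close> from any other while \<open>i\<close>
  and \<open>m\<close> stay fixed. It remains to change \<open>m\<close> along rings with \<open>i = 0\<close> and \<open>i\<close> along spokes.\<close>

lemma connected_G: "connected (with_proj G)"
proof -
  interpret pair_graph G by (rule pair_graph_G)
  define R where "R u v \<longleftrightarrow> (u, v) \<in> (parcs G)\<^sup>*" for u v
  have sym: "R u v \<Longrightarrow> R v u" for u v
  proof -
    have "sym ((parcs G)\<^sup>*)"
      by (rule sym_rtrancl) (simp add: arcs_G sym_Un_converse)
    then show "R u v \<Longrightarrow> R v u" unfolding R_def by (rule symD)
  qed
  have trans: "R u v \<Longrightarrow> R v w \<Longrightarrow> R u w" for u v w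
    unfolding R_def by (rule rtrancl_trans)
  have step: "R (vtx t) (vtx (go l t))" for t l
    unfolding R_def using arcs_act act_vtx vtx_in_V by (intro r_into_rtrancl) metis
  have walk: "R v (walk ls v)" if "v \<in> V" for ls v
    using that
  proof (induction ls arbitrary: v)
    case (Cons l ls)
    then show ?case using trans step V_cases act_vtx act_in_V by (metis walk.simps(2))
  qed (simp add: R_def)
  have level: "R (vtx (i, m, k)) (vtx (i, m, k'))" for i m k k'
  proof -
    obtain y where "[4 * y = 1] (mod int p)"
      using cong_solve_coprime_int[of 4 "int p"] coprime_4 by (auto simp: coprime_commute)
    then have "[4 * y * (k' - k) = 1 * (k' - k)] (mod int p)"
      by (rule cong_scalar_right)
    then obtain x where x: "[4 * x = k' - k] (mod int p)"
      by (simp add: mult.assoc)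
    define n where "n = nat (x mod int p)"
    have n: "int n = x mod int p" using p_pos by (simp add: n_def)
    have "[4 * int n = k' - k] (mod int p)"
      using x unfolding n cong_def by (simp add: mod_mult_right_eq)
    then have d: "int p dvd k' - (k + int n * 4)"
      by (simp add: cong_iff_dvd_diff dvd_diff_commute algebra_simps)
    have "walk (concat (replicate n (drift Ring Spoke))) (vtx (i, m, k)) = vtx (i, m + int n * 0, k + int n * 4)"
      by (rule drift_iterate) (simp_all add: perp_def drift_def numeral_eq_Suc)
    then have "R (vtx (i, m, k)) (vtx (i, m + int n * 0, k + int n * 4))"
      using walk vtx_in_V by metis
    also have "vtx (i, m + int n * 0, k + int n * 4) = vtx (i, m, k')"
      using d by (simp add: vtx_eq_iff)
    finally show ?thesis .
  qed
  have spoke: "R (vtx (i, m, k)) (vtx (i + 1, m - 1, k'))" for i m k k'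
  proof -
    have "R (vtx (i, m, k)) (vtx (i + 1, m - 1, k + 1))"
      using step[of "(i, m, k)" Spoke] by simp
    then show ?thesis by (rule trans) (rule level)
  qed
  have ring: "R (vtx (0, m, k)) (vtx (0, m + 1, k'))" for m k k'
  proof -
    have "R (vtx (0, m, k)) (vtx (0, m + 1, k + 1))"
      using step[of "(0, m, k)" Ring] by simp
    then show ?thesis by (rule trans) (rule level)
  qed
  have base: "R (vtx (0, 0, 0)) (vtx (0, int n, k))" for n k
  proof (induction n arbitrary: k)
    case (Suc n)
    have "R (vtx (0, int n, 0)) (vtx (0, int (Suc n), k))"
      using ring[of "int n" 0 k] by (simp add: add.commute)
    with Suc show ?case by (rule trans)
  qed (simp add: level)
  have layer: "R (vtx (0, 0, 0)) (vtx (int n, m, k))" for n m k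
  proof (induction n arbitrary: m k)
    case 0
    have "vtx (0, m, k) = vtx (0, int (nat (m mod 48)), k)"
      by (simp add: vtx_eq_iff mod_eq_dvd_iff[symmetric])
    then show ?case using base[of "nat (m mod 48)" k] by simp
  next
    case (Suc n)
    have "R (vtx (int n, m + 1, 0)) (vtx (int (Suc n), m, k))"
      using spoke[of "int n" "m + 1" 0 k] by (simp add: add.commute)
    with Suc show ?case by (rule trans)
  qed
  have all: "R (vtx (0, 0, 0)) v" if v: "v \<in> V" for v
  proof -
    obtain i m k where "v = vtx (i, m, k)" using v by (metis V_cases prod_cases3)
    also have "\<dots> = vtx (int (nat (i mod 4)), m, k)"
      by (simp add: vtx_eq_iff mod_eq_dvd_iff[symmetric])
    finally show ?thesis using layer by metis
  qed
  show ?thesis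
  proof (rule connectedI)
    show "V \<noteq> {}" using vtx_in_V by blast
    fix u v assume uv: "u \<in> V" "v \<in> V"
    then have "R u v" using trans[OF sym[OF all] all] by blast
    then have "u \<rightarrow>\<^sup>*\<^bsub>with_proj G\<^esub> v"
      unfolding R_def using uv by (simp add: reachable_conv')
    then show "u \<rightarrow>\<^sup>*\<^bsub>with_proj (mk_symmetric (with_proj G))\<^esub> v"
      by (rule reachable_mk_symmetricI)
  qed
qed

lemma quartic_half_arc_transitive: "connected_quartic_half_arc_transitive G"
  unfolding connected_quartic_half_arc_transitive_def regular_of_valency_def
  using pair_graph_G connected_G half_arc_transitive_G out_degree_4 by simp

end

section \<open>The metacirculant structure\<close>

context voltage_prime begin

text \<open>Adding 1 to \<open>k\<close> as well as to \<open>m\<close> makes the orbits of \<open>rho\<close> as large as whole layers, because 48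
  and \<open>p\<close> are coprime. With \<open>k\<close> fixed, an orbit would contain no edges at all.\<close>

definition rho :: "(nat \<times> nat) \<times> nat \<Rightarrow> (nat \<times> nat) \<times> nat" where
  "rho = induced (shift 0 1 1)"

definition sigma :: "(nat \<times> nat) \<times> nat \<Rightarrow> (nat \<times> nat) \<times> nat" where
  "sigma = induced (shift 1 0 0)"

definition layer :: "int \<Rightarrow> ((nat \<times> nat) \<times> nat) set" where
  "layer i = {vtx (i, m, k) | m k. True}"

lemma rho_aut: "rho \<in> automorphisms G" and sigma_aut: "sigma \<in> automorphisms G"
  unfolding rho_def sigma_def by (intro induced_automorphism shift_admissible)+

lemma rho_vtx: "rho (vtx (i, m, k)) = vtx (i, m + 1, k + 1)"
  and sigma_vtx: "sigma (vtx (i, m, k)) = vtx (i + 1, 13 * m + 12 * i, k)"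
  unfolding rho_def sigma_def by (simp_all add: induced_vtx[OF shift_admissible])

lemma rho_pow: "(rho ^^ n) (vtx (i, m, k)) = vtx (i, m + int n, k + int n)"
  by (induction n) (simp_all add: rho_vtx algebra_simps)

lemma simultaneous_shift: "\<exists>n>0. 48 dvd a - int n \<and> int p dvd b - int n"
proof -
  obtain x where x: "[x = a] (mod 48)" "[x = b] (mod int p)"
    using binary_chinese_remainder_int[of 48 "int p"] coprime_48 by (auto simp: coprime_commute)
  define y where "y = x mod (48 * int p) + 48 * int p"
  have y: "0 < y" using p_pos by (simp add: y_def add_nonneg_pos)
  have "[y = a] (mod 48)" "[y = b] (mod int p)"
    using x by (simp_all add: y_def cong_def mod_mod_cancel)
  then show ?thesis
    using y by (intro exI[of _ "nat y"]) (simp add: cong_iff_dvd_diff dvd_diff_commute)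
qed

lemma fst_vtx: "fst (fst (vtx (i, m, k))) = nat (i mod 4)"
  by (simp add: vtx.simps)

lemma layer_iff: "v \<in> layer i \<longleftrightarrow> v \<in> V \<and> fst (fst v) = nat (i mod 4)"
proof
  assume "v \<in> layer i"
  then show "v \<in> V \<and> fst (fst v) = nat (i mod 4)" by (auto simp: layer_def fst_vtx)
next
  assume v: "v \<in> V \<and> fst (fst v) = nat (i mod 4)"
  then obtain i' m k where t: "v = vtx (i', m, k)" by (metis V_cases prod_cases3)
  have "nat (i' mod 4) = nat (i mod 4)" using v by (simp add: t fst_vtx)
  then have "i' mod 4 = i mod 4" by (simp add: eq_nat_nat_iff)
  then have "v = vtx (i, m, k)" by (simp add: t vtx_eq_iff mod_eq_dvd_iff[symmetric])
  then show "v \<in> layer i" by (auto simp: layer_def)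
qed

lemma vtx_in_layer [simp]: "vtx (i, m, k) \<in> layer j \<longleftrightarrow> 4 dvd j - i"
proof -
  have "nat (i mod 4) = nat (j mod 4) \<longleftrightarrow> i mod 4 = j mod 4" by (simp add: eq_nat_nat_iff)
  then show ?thesis by (simp add: layer_iff fst_vtx mod_eq_dvd_iff dvd_diff_commute)
qed

lemma orbit_rho: "orbit rho (vtx (i, m, k)) = layer i"
proof (intro equalityI subsetI)
  fix v assume "v \<in> orbit rho (vtx (i, m, k))"
  then obtain n where "v = (rho ^^ n) (vtx (i, m, k))" unfolding orbit_altdef by blast
  then show "v \<in> layer i" by (simp add: rho_pow)
next
  fix v assume "v \<in> layer i"
  then obtain m' k' where v: "v = vtx (i, m', k')" by (auto simp: layer_def)
  obtain n where "n > 0" "48 dvd (m' - m) - int n" "int p dvd (k' - k) - int n"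
    using simultaneous_shift by blast
  then have "0 < n" "v = (rho ^^ n) (vtx (i, m, k))"
    by (auto simp: v rho_pow vtx_eq_iff diff_diff_eq dvd_diff_commute)
  then show "v \<in> orbit rho (vtx (i, m, k))" unfolding orbit_altdef by blast
qed

lemma layer_eq_iff: "layer i = layer j \<longleftrightarrow> 4 dvd j - i"
proof
  assume "layer i = layer j"
  moreover have "vtx (i, 0, 0) \<in> layer i" by simp
  ultimately show "4 dvd j - i" by (metis vtx_in_layer)
next
  assume "4 dvd j - i"
  then have "j mod 4 = i mod 4" by (simp add: mod_eq_dvd_iff)
  then show "layer i = layer j" by (auto simp: layer_iff)
qed

lemma card_layer: "card (layer i) = 48 * p"
proof -
  have "nat (i mod 4) < 4" by (simp add: nat_less_iff)
  then have "layer i = ({nat (i mod 4)} \<times> {..<48}) \<times> {..<p}"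
    by (auto simp: layer_iff V_eq_Times)
  then show ?thesis by simp
qed

lemma orbits_rho: "orbits_of G rho = layer ` UNIV" "orbits_of G rho = {layer 0, layer 1, layer 2, layer 3}"
proof -
  show *: "orbits_of G rho = layer ` UNIV"
  proof (intro equalityI subsetI)
    fix B assume "B \<in> orbits_of G rho"
    then obtain v where "v \<in> V" "B = orbit rho v" by (auto simp: orbits_of_def)
    moreover obtain i m k where "v = vtx (i, m, k)" using calculation(1) by (metis V_cases prod_cases3)
    ultimately show "B \<in> layer ` UNIV" by (simp add: orbit_rho)
  next
    fix B assume "B \<in> layer ` UNIV"
    then obtain i where "B = orbit rho (vtx (i, 0, 0))" by (auto simp: orbit_rho)
    then show "B \<in> orbits_of G rho" by (auto simp: orbits_of_def)
  qed
  have "layer i \<in> {layer 0, layer 1, layer 2, layer 3}" for i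
  proof -
    have "i mod 4 = 0 \<or> i mod 4 = 1 \<or> i mod 4 = 2 \<or> i mod 4 = 3" by presburger
    then have "layer (i mod 4) \<in> {layer 0, layer 1, layer 2, layer 3}" by (elim disjE) simp_all
    moreover have "layer (i mod 4) = layer i" by (simp add: layer_eq_iff mod_eq_dvd_iff[symmetric])
    ultimately show ?thesis by simp
  qed
  then show "orbits_of G rho = {layer 0, layer 1, layer 2, layer 3}"
    unfolding * by blast
qed

lemma semiregular_rho: "semiregular 4 (48 * p) G rho"
proof -
  have "card (orbits_of G rho) = 4"
    unfolding orbits_rho(2) by (simp add: layer_eq_iff card_insert_if)
  then show ?thesis
    using rho_aut by (simp add: semiregular_def orbits_rho(1) card_layer)
qed

lemma sigma_layer: "sigma ` layer i = layer (i + 1)"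
proof (intro equalityI subsetI)
  fix v assume "v \<in> sigma ` layer i"
  then obtain m k where "v = sigma (vtx (i, m, k))" by (auto simp: layer_def)
  then show "v \<in> layer (i + 1)" by (simp add: sigma_vtx)
next
  fix v assume "v \<in> layer (i + 1)"
  then obtain m k where v: "v = vtx (i + 1, m, k)" by (auto simp: layer_def)
  \<comment> \<open>37 is the inverse of 13 modulo 48\<close>
  have "sigma (vtx (i, 37 * (m - 12 * i), k)) = vtx (i + 1, m, k)"
    by (simp add: sigma_vtx vtx_eq_iff)
  then show "v \<in> sigma ` layer i" unfolding v by (metis imageI vtx_in_layer diff_self dvd_0_right)
qed

lemma cyclic_sigma: "cyclic_on ((`) sigma) (orbits_of G rho)"
  unfolding cyclic_on_def
proof (intro bexI)
  have pow: "((`) sigma ^^ n) (layer 0) = layer (int n)" for n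
    by (induction n) (simp_all add: sigma_layer add.commute)
  have "layer i \<in> orbit ((`) sigma) (layer 0)" for i
  proof -
    \<comment> \<open>orbits are formed with positive exponents, hence the additional 4\<close>
    have "layer i = ((`) sigma ^^ nat (i mod 4 + 4)) (layer 0)"
      by (simp add: pow layer_eq_iff mod_eq_dvd_iff[symmetric])
    moreover have "0 < nat (i mod 4 + 4)" by (simp add: add_nonneg_pos)
    ultimately show ?thesis unfolding orbit_altdef by blast
  qed
  then show "orbits_of G rho = orbit ((`) sigma) (layer 0)"
    unfolding orbits_rho(1) unfolding orbit_altdef pow by blast
  show "layer 0 \<in> orbits_of G rho" unfolding orbits_rho(1) by blast
qed

text \<open>\<open>sigma\<close> multiplies \<open>m\<close> by 13 and leaves \<open>k\<close> alone, so the exponent \<open>r\<close> has to be 13 modulo 48 and 1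
  modulo \<open>p\<close>.\<close>

lemma weak_metacirculant_G: "weak_metacirculant 4 (48 * p) G rho sigma"
proof -
  have cop: "coprime (48::nat) p"
    using coprime_48 by (metis coprime_commute coprime_int_iff of_nat_numeral)
  obtain r where r: "r < 48 * p" "[r = 13] (mod 48)" "[r = 1] (mod p)"
    using binary_chinese_remainder_unique_nat[OF cop] p_pos by (metis neq0_conv zero_neq_numeral)
  have "coprime (13::nat) 48" by code_simp
  then have "coprime r 48" using cong_imp_coprime[OF cong_sym[OF r(2)]] by blast
  moreover have "coprime r p" using cong_imp_coprime[OF cong_sym[OF r(3)]] by simp
  ultimately have copr: "coprime r (48 * p)" by simp
  have r_int: "[int r = 13] (mod 48)" "[int r = 1] (mod int p)"
    using r(2,3) cong_int_iff by (metis of_nat_numeral, metis of_nat_1)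
  have fixed: "rho x = x" "sigma x = x" "(rho ^^ n) x = x" if "x \<notin> V" for x n
    using that by (induction n) (simp_all add: rho_def sigma_def induced_def)
  have "sigma \<circ> rho = rho ^^ r \<circ> sigma"
  proof
    fix x
    show "(sigma \<circ> rho) x = (rho ^^ r \<circ> sigma) x"
    proof (cases "x \<in> V")
      case True
      then obtain i m k where x: "x = vtx (i, m, k)" by (metis V_cases prod_cases3)
      have "48 dvd int r - 13" "int p dvd int r - 1"
        using r_int by (simp_all add: cong_iff_dvd_diff)
      then show ?thesis
        by (simp add: x rho_vtx sigma_vtx rho_pow vtx_eq_iff algebra_simps)
    next
      case False
      then show ?thesis using fixed by simp
    qed
  qed
  then have "sigma \<circ> rho \<circ> inv sigma = rho ^^ r \<circ> (sigma \<circ> inv sigma)"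
    by (simp only: comp_assoc)
  moreover have "sigma permutes V"
    using sigma_aut by (simp add: automorphisms_def)
  ultimately have "sigma \<circ> rho \<circ> inv sigma = rho ^^ r"
    by (simp add: permutes_inv_o)
  then show ?thesis
    unfolding weak_metacirculant_def
    using semiregular_rho sigma_aut cyclic_sigma r(1) copr p_pos by auto
qed

lemma act_layer:
  assumes "v \<in> layer i"
  shows "act Ring v \<in> layer j \<longleftrightarrow> 4 dvd j - i" "act Ring' v \<in> layer j \<longleftrightarrow> 4 dvd j - i"
    "act Spoke v \<in> layer j \<longleftrightarrow> 4 dvd j - (i + 1)" "act Spoke' v \<in> layer j \<longleftrightarrow> 4 dvd j - (i - 1)"
proof -
  obtain m k where "v = vtx (i, m, k)" using assms by (auto simp: layer_def)
  then show "act Ring v \<in> layer j \<longleftrightarrow> 4 dvd j - i" "act Ring' v \<in> layer j \<longleftrightarrow> 4 dvd j - i"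
    "act Spoke v \<in> layer j \<longleftrightarrow> 4 dvd j - (i + 1)" "act Spoke' v \<in> layer j \<longleftrightarrow> 4 dvd j - (i - 1)"
    by simp_all
qed

lemma layer_V: "v \<in> layer i \<Longrightarrow> v \<in> V"
  by (simp add: layer_iff)

lemma neighbours_in_layer:
  assumes "v \<in> layer i"
  shows "{w \<in> layer j. (v, w) \<in> parcs G} = (\<lambda>l. act l v) ` {l \<in> {Ring, Spoke, Ring', Spoke'}. act l v \<in> layer j}"
proof -
  have "{w \<in> layer j. (v, w) \<in> parcs G} = layer j \<inter> {w. (v, w) \<in> parcs G}" by blast
  also have "\<dots> = layer j \<inter> (\<lambda>l. act l v) ` {Ring, Spoke, Ring', Spoke'}"
    unfolding neighbours[OF layer_V[OF assms]] ..
  also have "\<dots> = (\<lambda>l. act l v) ` {l \<in> {Ring, Spoke, Ring', Spoke'}. act l v \<in> layer j}"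
    by blast
  finally show ?thesis .
qed

lemma layer_valency: "regular_of_valency 2 (with_proj G \<restriction> layer i)"
  unfolding regular_of_valency_def
proof
  fix v assume "v \<in> verts (with_proj G \<restriction> layer i)"
  then have v: "v \<in> layer i" by simp
  have "out_arcs (with_proj G \<restriction> layer i) v = Pair v ` {w \<in> layer i. (v, w) \<in> parcs G}"
    using v by (auto simp: out_arcs_def)
  also have "{w \<in> layer i. (v, w) \<in> parcs G} = {act Ring v, act Ring' v}"
    unfolding neighbours_in_layer[OF v] by (auto simp: act_layer[OF v])
  finally have "out_degree (with_proj G \<restriction> layer i) v = card {(v, act Ring v), (v, act Ring' v)}"
    by (simp add: out_degree_def)
  moreover have "act Ring v \<noteq> act Ring' v" using act_inject[OF layer_V[OF v]] by blast
  ultimately show "out_degree (with_proj G \<restriction> layer i) v = 2" by simp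
qed

lemma adjacent_layers: "adjacent_orbits G rho (layer i) = {layer (i + 1), layer (i - 1)}"
proof -
  have 1: "vtx (i, 0, 0) \<in> layer i" by simp
  have *: "(\<exists>u \<in> layer i. \<exists>v \<in> layer j. (u, v) \<in> parcs G) \<longleftrightarrow> 4 dvd j - i \<or> 4 dvd j - (i + 1) \<or> 4 dvd j - (i - 1)"
    (is "?L \<longleftrightarrow> ?R") for j
  proof
    assume ?L
    then obtain u v where uv: "u \<in> layer i" "v \<in> layer j" "(u, v) \<in> parcs G" by blast
    then obtain l where "v = act l u" by (auto simp: arcs_act)
    then show ?R using uv(2) act_layer[OF uv(1), of j] by (cases l) simp_all
  next
    assume R: ?R
    have "\<exists>l. act l (vtx (i, 0, 0)) \<in> layer j"
      using R act_layer(1,3,4)[OF 1, of j] by metis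
    then obtain l where "act l (vtx (i, 0, 0)) \<in> layer j" ..
    moreover have "(vtx (i, 0, 0), act l (vtx (i, 0, 0))) \<in> parcs G"
      using vtx_in_V arcs_act by blast
    ultimately show ?L using 1 by blast
  qed
  show ?thesis
  proof (intro equalityI subsetI)
    fix B assume "B \<in> adjacent_orbits G rho (layer i)"
    then obtain j where j: "B = layer j" "layer j \<noteq> layer i"
      and "\<exists>u \<in> layer i. \<exists>v \<in> layer j. (u, v) \<in> parcs G"
      unfolding adjacent_orbits_def orbits_rho(1) by blast
    then have "4 dvd j - (i + 1) \<or> 4 dvd j - (i - 1)"
      using *[of j] layer_eq_iff[of i j] by metis
    then show "B \<in> {layer (i + 1), layer (i - 1)}"
      unfolding j(1) using layer_eq_iff by blast
  next
    fix B assume "B \<in> {layer (i + 1), layer (i - 1)}"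
    then consider "B = layer (i + 1)" | "B = layer (i - 1)" by blast
    then obtain j where j: "B = layer j" "j = i + 1 \<or> j = i - 1" by cases blast+
    then have "B \<noteq> layer i" using layer_eq_iff by auto
    moreover have "\<exists>u \<in> layer i. \<exists>v \<in> B. (u, v) \<in> parcs G"
      unfolding j(1) using *[of j] j(2) by auto
    ultimately show "B \<in> adjacent_orbits G rho (layer i)"
      unfolding adjacent_orbits_def orbits_rho(1) j(1) by blast
  qed
qed

lemma class_II_G: "class_II_weak_metacirculant G"
  unfolding class_II_weak_metacirculant_def
proof (intro exI conjI ballI)
  show "weak_metacirculant 4 (48 * p) G rho sigma" by (rule weak_metacirculant_G)
  fix B assume "B \<in> orbits_of G rho"
  then obtain i where B: "B = layer i" unfolding orbits_rho(1) by blast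
  show "regular_of_valency 2 (with_proj G \<restriction> B)" unfolding B by (rule layer_valency)
  show "card (adjacent_orbits G rho B) = 2"
    unfolding B adjacent_layers by (simp add: layer_eq_iff)
  fix B' u assume B': "B' \<in> adjacent_orbits G rho B" and u: "u \<in> B"
  have u': "u \<in> layer i" using u B by simp
  consider "B' = layer (i + 1)" | "B' = layer (i - 1)"
    using B' unfolding B adjacent_layers by blast
  then show "card {v \<in> B'. (u, v) \<in> parcs G} = 1"
  proof cases
    case 1
    have "{v \<in> B'. (u, v) \<in> parcs G} = {act Spoke u}"
      unfolding 1 neighbours_in_layer[OF u'] by (auto simp: act_layer[OF u'])
    then show ?thesis by simp
  next
    case 2
    have "{v \<in> B'. (u, v) \<in> parcs G} = {act Spoke' u}"
      unfolding 2 neighbours_in_layer[OF u'] by (auto simp: act_layer[OF u'])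
    then show ?thesis by simp
  qed
qed

end

section \<open>Alternating cycles\<close>

lemma pcas_nth:
  assumes "pcas u q v" "j < length q"
  shows "q ! j = (pawalk_verts u q ! j, pawalk_verts u q ! Suc j)"
  using assms
proof (induction q arbitrary: u j)
  case (Cons e q)
  have hd: "pawalk_verts (snd e) q ! 0 = snd e"
    using Cons.prems(1) by (cases q) auto
  show ?case
  proof (cases j)
    case 0
    then show ?thesis using Cons.prems hd by (cases e) simp
  next
    case (Suc i)
    then show ?thesis using Cons.prems Cons.IH[of "snd e" i] by simp
  qed
qed simp

lemma pcas_ends:
  assumes "pcas u q v"
  shows "pawalk_verts u q ! 0 = u" "pawalk_verts u q ! length q = v" "length (pawalk_verts u q) = Suc (length q)"
proof -
  show "pawalk_verts u q ! 0 = u" using assms by (cases q) auto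
  show "pawalk_verts u q ! length q = v" "length (pawalk_verts u q) = Suc (length q)"
    using assms by (induction q arbitrary: u) auto
qed

lemma pcas_map:
  "pcas (g a) (map (\<lambda>j. (g j, g (Suc j))) [a..<a + n]) (g (a + n)) \<and>
   pawalk_verts (g a) (map (\<lambda>j. (g j, g (Suc j))) [a..<a + n]) = map g [a..<Suc (a + n)]"
proof (induction n arbitrary: a)
  case (Suc n)
  have "[a..<a + Suc n] = a # [Suc a..<Suc a + n]" "[a..<Suc (a + Suc n)] = a # [Suc a..<Suc (Suc a + n)]"
    by (simp_all add: upt_conv_Cons)
  then show ?case using Suc[of "Suc a"] by simp
qed simp

lemma eq_if_dvd_diff:
  assumes "n dvd int b - int a" "\<bar>int b - int a\<bar> < n" shows "a = b"
proof (rule ccontr)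
  assume "a \<noteq> b"
  then have "\<bar>n\<bar> \<le> \<bar>int b - int a\<bar>" using dvd_imp_le_int[OF _ assms(1)] by simp
  then show False using assms(2) by simp
qed

text \<open>The closed form of the \<open>n\<close>-th power of the step pair \<open>Ring\<close>, inverse \<open>Spoke\<close>. It makes sense for
  negative \<open>n\<close> too, where it describes the traversal in the opposite direction.\<close>

fun tail_at :: "int \<times> int \<times> int \<Rightarrow> int \<Rightarrow> int \<times> int \<times> int" where
  "tail_at (i, m, k) n = (i - n, m + 2 * n + 12 * n * i - 6 * (n * (n - 1)), k)"

lemma tail_at_0 [simp]: "tail_at t 0 = t"
  by (cases t) simp

lemma tail_at_add: "tail_at (tail_at t a) b = tail_at t (a + b)"
  by (cases t) (simp add: algebra_simps)

lemma go_Spoke_tail_at: "go Spoke (tail_at t n) = go Ring (tail_at t (n - 1))"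
  by (cases t) (simp add: algebra_simps)

context voltage_prime begin

text \<open>The vertices of an alternating cycle in cyclic order, indexed by all integers: tails at even and
  heads at odd positions.\<close>

definition zigzag :: "int \<times> int \<times> int \<Rightarrow> int \<Rightarrow> (nat \<times> nat) \<times> nat" where
  "zigzag t j = (if even j then vtx (tail_at t (j div 2)) else vtx (go Ring (tail_at t (j div 2))))"

definition zigzag_edges :: "int \<times> int \<times> int \<Rightarrow> ((nat \<times> nat) \<times> nat) set set" where
  "zigzag_edges t = {{zigzag t j, zigzag t (j + 1)} | j. True}"

lemma zigzag_even [simp]: "zigzag t (2 * n) = vtx (tail_at t n)"
  and zigzag_odd [simp]: "zigzag t (2 * n + 1) = vtx (go Ring (tail_at t n))"
  by (simp_all add: zigzag_def)

lemma zigzag_out: "(zigzag t (2 * n), w) \<in> D \<longleftrightarrow> w \<in> {zigzag t (2 * n - 1), zigzag t (2 * n + 1)}"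
proof -
  have "(zigzag t (2 * n), w) \<in> D \<longleftrightarrow> w = vtx (go Spoke (tail_at t n)) \<or> w = vtx (go Ring (tail_at t n))"
    by (auto simp: D_act forward_def)
  moreover have "zigzag t (2 * n - 1) = vtx (go Spoke (tail_at t n))"
    using zigzag_odd[of t "n - 1"] by (simp add: go_Spoke_tail_at)
  ultimately show ?thesis by simp
qed

lemma zigzag_in: "(w, zigzag t (2 * n + 1)) \<in> D \<longleftrightarrow> w \<in> {zigzag t (2 * n), zigzag t (2 * n + 2)}"
proof
  assume "(w, zigzag t (2 * n + 1)) \<in> D"
  then obtain l where l: "w \<in> V" "l \<in> forward" "vtx (go Ring (tail_at t n)) = act l w"
    by (auto simp: D_act)
  consider "l = Ring" | "l = Spoke" using l(2) by (auto simp: forward_def)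
  then show "w \<in> {zigzag t (2 * n), zigzag t (2 * n + 2)}"
  proof cases
    case 1
    then have "w = act Ring' (vtx (go Ring (tail_at t n)))" using l act_inv(1)[OF l(1), of Ring] by simp
    then have "w = zigzag t (2 * n)" using go_inv(1)[of Ring "tail_at t n"] by simp
    then show ?thesis by simp
  next
    case 2
    have "go Ring (tail_at t n) = go Spoke (tail_at t (n + 1))" by (simp add: go_Spoke_tail_at)
    then have "w = act Spoke' (vtx (go Spoke (tail_at t (n + 1))))"
      using 2 l act_inv(1)[OF l(1), of Spoke] by simp
    then have "w = vtx (tail_at t (n + 1))" using go_inv(1)[of Spoke "tail_at t (n + 1)"] by simp
    also have "\<dots> = zigzag t (2 * n + 2)" using zigzag_even[of t "n + 1"] by (simp add: distrib_left)
    finally show ?thesis by simp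
  qed
next
  assume "w \<in> {zigzag t (2 * n), zigzag t (2 * n + 2)}"
  moreover have "(zigzag t (2 * n), zigzag t (2 * n + 1)) \<in> D" unfolding zigzag_out by simp
  moreover have "(zigzag t (2 * (n + 1)), zigzag t (2 * (n + 1) - 1)) \<in> D" unfolding zigzag_out by simp
  ultimately show "(w, zigzag t (2 * n + 1)) \<in> D" by (auto simp: algebra_simps)
qed

text \<open>Equality of \<open>i\<close> gives \<open>n' = n + 4 s\<close>, and the difference of the two values of \<open>m\<close> is then
  \<open>32 s\<close> modulo 48.\<close>

lemma tail_at_eq_iff: "vtx (tail_at t n) = vtx (tail_at t n') \<longleftrightarrow> 12 dvd n' - n"
proof -
  obtain i m k where t: "t = (i, m, k)" by (cases t)
  let ?e = "(m + 2 * n' + 12 * n' * i - 6 * (n' * (n' - 1))) - (m + 2 * n + 12 * n * i - 6 * (n * (n - 1)))"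
  have *: "?e = 32 * s + 48 * (i * s - 2 * s * s - n * s)" if "n' = n + 4 * s" for s
    unfolding that by (simp add: algebra_simps)
  have "48 dvd ?e \<longleftrightarrow> 12 dvd n' - n" if "4 dvd n' - n"
  proof -
    obtain s where "n' - n = 4 * s" using \<open>4 dvd n' - n\<close> by (rule dvdE)
    then have s: "n' = n + 4 * s" by simp
    have "48 dvd ?e \<longleftrightarrow> 48 dvd 32 * s" unfolding *[OF s]
      by (rule dvd_add_left_iff) simp
    also have "\<dots> \<longleftrightarrow> 12 dvd 4 * s" by presburger
    finally show ?thesis by (simp add: s)
  qed
  moreover have "12 dvd n' - n \<Longrightarrow> 4 dvd n' - n" by presburger
  moreover have "4 dvd (i - n') - (i - n) \<longleftrightarrow> 4 dvd n' - n" by (simp add: dvd_diff_commute)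
  ultimately show ?thesis
    unfolding t tail_at.simps vtx_eq_iff by auto
qed

lemma vtx_go_eq_iff: "vtx (go l t) = vtx (go l t') \<longleftrightarrow> vtx t = vtx t'"
  using vtx_go_cong[of "go l t" "go l t'" "inv_letter l"] vtx_go_cong[of t t' l] by auto

lemma tail_neq_head: "vtx (tail_at t n) \<noteq> vtx (go Ring (tail_at t n'))"
proof -
  obtain i m k where t: "t = (i, m, k)" by (cases t)
  show ?thesis using small_multiple[of 1] by (auto simp: t vtx_eq_iff)
qed

lemma zigzag_eq_iff: "zigzag t a = zigzag t b \<longleftrightarrow> 24 dvd b - a"
proof -
  define x y where "x = a div 2" and "y = b div 2"
  have "a = 2 * x \<or> a = 2 * x + 1" "b = 2 * y \<or> b = 2 * y + 1"
    unfolding x_def y_def by presburger+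
  moreover have "24 dvd 2 * y - 2 * x \<longleftrightarrow> 12 dvd y - x" by presburger
  moreover have "\<not> 24 dvd (2 * y + 1) - 2 * x" "\<not> 24 dvd 2 * y - (2 * x + 1)" by presburger+
  ultimately show ?thesis
    using tail_neq_head[of t x y] tail_neq_head[of t y x]
    by (elim disjE) (auto simp: tail_at_eq_iff vtx_go_eq_iff)
qed

lemma zigzag_shift: "zigzag (tail_at t n) j = zigzag t (2 * n + j)"
  by (simp add: zigzag_def tail_at_add)

lemma zigzag_cong:
  assumes "vtx t = vtx t'" shows "zigzag t = zigzag t'"
proof -
  obtain i m k i' m' k' where t: "t = (i, m, k)" "t' = (i', m', k')" by (cases t; cases t')
  have d: "4 dvd i' - i" "48 dvd m' - m" "int p dvd k' - k"
    using assms by (auto simp: t vtx_eq_iff)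
  obtain x where "i' - i = 4 * x" using d(1) by (rule dvdE)
  moreover obtain y where "m' - m = 48 * y" using d(2) by (rule dvdE)
  ultimately have xy: "i' = i + 4 * x" "m' = m + 48 * y" by simp_all
  have "vtx (tail_at t n) = vtx (tail_at t' n)" for n
    using d(3) by (simp add: t vtx_eq_iff xy algebra_simps)
  then show ?thesis
    unfolding zigzag_def fun_eq_iff by (simp add: vtx_go_eq_iff)
qed

lemma zigzag_edges_cong: "vtx t = vtx t' \<Longrightarrow> zigzag_edges t = zigzag_edges t'"
  unfolding zigzag_edges_def by (metis zigzag_cong)

lemma zigzag_edges_shift: "zigzag_edges (tail_at t n) = zigzag_edges t"
proof -
  have "\<exists>i. {zigzag t (2 * n + j), zigzag t (2 * n + (j + 1))} = {zigzag t i, zigzag t (i + 1)}" for j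
    by (rule exI[of _ "2 * n + j"]) (simp add: add.assoc)
  moreover have "\<exists>i. {zigzag t j, zigzag t (j + 1)} = {zigzag t (2 * n + i), zigzag t (2 * n + (i + 1))}" for j
    by (rule exI[of _ "j - 2 * n"]) simp
  ultimately show ?thesis
    unfolding zigzag_edges_def zigzag_shift by blast
qed

lemma Union_zigzag: "\<Union>(zigzag_edges t) = range (zigzag t)"
  unfolding zigzag_edges_def by blast

lemma zigzag_edges_range:
  assumes "s = 1 \<or> s = - 1"
  shows "zigzag_edges t = (\<lambda>j. {zigzag t (c + s * int j), zigzag t (c + s * int (Suc j))}) ` {..<24}"
proof (intro equalityI subsetI)
  fix e assume "e \<in> zigzag_edges t"
  then obtain a where a: "e = {zigzag t a, zigzag t (a + 1)}" unfolding zigzag_edges_def by blast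
  have period: "zigzag t x = zigzag t y" if "x = y + 24 * z" for x y z
    using that by (simp add: zigzag_eq_iff)
  show "e \<in> (\<lambda>j. {zigzag t (c + s * int j), zigzag t (c + s * int (Suc j))}) ` {..<24}"
    using assms
  proof
    assume s: "s = 1"
    define j where "j = nat ((a - c) mod 24)"
    have j: "j < 24" "int j = (a - c) - 24 * ((a - c) div 24)"
      by (simp_all add: j_def nat_less_iff minus_mult_div_eq_mod)
    have "zigzag t (c + s * int j) = zigzag t a"
      by (rule period[of _ _ "- ((a - c) div 24)"]) (simp add: s j)
    moreover have "zigzag t (c + s * int (Suc j)) = zigzag t (a + 1)"
      by (rule period[of _ _ "- ((a - c) div 24)"]) (simp add: s j)
    ultimately show ?thesis
      using j(1) unfolding a by (intro image_eqI[of _ _ j]) (simp_all only: lessThan_iff insert_commute)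
  next
    assume s: "s = - 1"
    define j where "j = nat ((c - a - 1) mod 24)"
    have j: "j < 24" "int j = (c - a - 1) - 24 * ((c - a - 1) div 24)"
      by (simp_all add: j_def nat_less_iff minus_mult_div_eq_mod)
    have "zigzag t (c + s * int j) = zigzag t (a + 1)"
      by (rule period[of _ _ "(c - a - 1) div 24"]) (simp add: s j)
    moreover have "zigzag t (c + s * int (Suc j)) = zigzag t a"
      by (rule period[of _ _ "(c - a - 1) div 24"]) (simp add: s j)
    ultimately show ?thesis
      using j(1) unfolding a by (intro image_eqI[of _ _ j]) (simp_all only: lessThan_iff insert_commute)
  qed
next
  fix e assume "e \<in> (\<lambda>j. {zigzag t (c + s * int j), zigzag t (c + s * int (Suc j))}) ` {..<24}"
  then obtain j where e: "e = {zigzag t (c + s * int j), zigzag t (c + s * int (Suc j))}" by blast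
  show "e \<in> zigzag_edges t"
    using assms
  proof
    assume "s = 1"
    then have "e = {zigzag t (c + int j), zigzag t (c + int j + 1)}" by (simp add: e algebra_simps)
    then show ?thesis unfolding zigzag_edges_def by blast
  next
    assume "s = - 1"
    then have "e = {zigzag t (c - 1 - int j), zigzag t ((c - 1 - int j) + 1)}"
      by (simp add: e algebra_simps insert_commute)
    then show ?thesis unfolding zigzag_edges_def by blast
  qed
qed

lemma card_zigzag_edges: "card (zigzag_edges t) = 24"
proof -
  have "inj_on (\<lambda>j. {zigzag t (1 * int j), zigzag t (1 * int (Suc j))}) {..<24}"
  proof (rule inj_onI)
    fix a b :: nat
    assume ab: "a \<in> {..<24}" "b \<in> {..<24}"
      and "{zigzag t (1 * int a), zigzag t (1 * int (Suc a))} = {zigzag t (1 * int b), zigzag t (1 * int (Suc b))}"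
    then have "zigzag t (int a) = zigzag t (int b) \<or>
        zigzag t (int a) = zigzag t (int (Suc b)) \<and> zigzag t (int (Suc a)) = zigzag t (int b)"
      unfolding doubleton_eq_iff by auto
    then have "24 dvd int b - int a \<or> 24 dvd int (Suc b) - int a \<and> 24 dvd int b - int (Suc a)"
      unfolding zigzag_eq_iff .
    moreover have "\<not> (24 dvd int (Suc b) - int a \<and> 24 dvd int b - int (Suc a))"
    proof
      assume "24 dvd int (Suc b) - int a \<and> 24 dvd int b - int (Suc a)"
      then have "24 dvd (int (Suc b) - int a) - (int b - int (Suc a))" using dvd_diff by blast
      then show False by simp
    qed
    ultimately have "24 dvd int b - int a" by blast
    then show "a = b" using ab by (intro eq_if_dvd_diff) auto
  qed
  then show ?thesis
    using zigzag_edges_range[of 1 t 0] by (simp add: card_image)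
qed

text \<open>An alternating cycle never goes back to the vertex before the last, so its first arc determines it: at
  each tail the next vertex is the other head, at each head the other tail. The sign \<open>s\<close> records
  in which direction the zigzag is traversed.\<close>

lemma alternating_cycle_zigzag:
  assumes "C \<in> alternating_cycles G D"
  obtains t where "C = zigzag_edges t"
proof -
  obtain q where C: "C = (\<lambda>(u, v). {u, v}) ` set q"
    and cyc: "pre_digraph.cycle (with_proj G) q" and len: "3 \<le> length q" and even: "even (length q)"
    and alt: "\<And>i. i < length q \<Longrightarrow> if even i then q ! i \<in> D else prod.swap (q ! i) \<in> D"
    using assms unfolding alternating_cycles_def by blast
  obtain u where awalk: "pre_digraph.awalk (with_proj G) u q u"
    and dist: "distinct (tl (pawalk_verts u q))"
    using cyc unfolding pre_digraph.cycle_def awalk_verts_with_proj_eq by blast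
  have u: "u \<in> V" and cas: "pcas u q u"
    using awalk unfolding pre_digraph.awalk_def cas_with_proj_eq by simp_all
  define w where "w j = pawalk_verts u q ! j" for j
  let ?L = "length q"
  have q: "q ! j = (w j, w (Suc j))" if "j < ?L" for j
    using pcas_nth[OF cas that] by (simp add: w_def)
  have ends: "w 0 = u" "w ?L = u" and lenv: "length (pawalk_verts u q) = Suc ?L"
    using pcas_ends[OF cas] by (simp_all add: w_def)
  have w_neq: "w a \<noteq> w b" if "1 \<le> a" "a < b" "b \<le> ?L" for a b
  proof -
    have "tl (pawalk_verts u q) ! (a - 1) \<noteq> tl (pawalk_verts u q) ! (b - 1)"
      using that dist lenv by (simp add: nth_eq_iff_index_eq)
    then show ?thesis using that lenv by (simp add: nth_tl w_def)
  qed
  have skip: "w (Suc (Suc j)) \<noteq> w j" if "Suc (Suc j) \<le> ?L" for j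
  proof (cases "j = 0")
    case True
    have "w 2 \<noteq> w ?L" using len by (intro w_neq) auto
    then show ?thesis using True ends by (simp add: numeral_2_eq_2)
  next
    case False
    then show ?thesis using w_neq[of j "Suc (Suc j)"] that by auto
  qed
  obtain t where t: "u = vtx t" using V_cases[OF u] .
  have z0: "zigzag t 0 = u" by (simp add: zigzag_def t)
  have "0 < ?L" using len by linarith
  then have "(w 0, w (Suc 0)) \<in> D" using alt[of 0] q[of 0] by simp
  then have "(zigzag t (2 * 0), w (Suc 0)) \<in> D" using z0 ends(1) by simp
  then obtain s :: int where s: "s = 1 \<or> s = - 1" and s1: "w (Suc 0) = zigzag t s"
    unfolding zigzag_out by auto
  have nbr: "y \<in> {zigzag t (j - 1), zigzag t (j + 1)}"
    if "if even j then (zigzag t j, y) \<in> D else (y, zigzag t j) \<in> D" for j y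
  proof (cases "even j")
    case True
    then obtain n where "j = 2 * n" by blast
    then show ?thesis using that zigzag_out[of t n y] by simp
  next
    case False
    then obtain n where n: "j = 2 * n + 1" by (blast elim: oddE)
    have e: "j - 1 = 2 * n" "j + 1 = 2 * n + 2" using n by auto
    have "(y, zigzag t (2 * n + 1)) \<in> D" using that False unfolding n by (simp only: if_False)
    then show ?thesis unfolding e using zigzag_in[of y t n] by blast
  qed
  have w: "Suc j \<le> ?L \<Longrightarrow> w j = zigzag t (s * int j) \<and> w (Suc j) = zigzag t (s * int (Suc j))" for j
  proof (induction j)
    case 0
    then show ?case using z0 ends s1 by simp
  next
    case (Suc j)
    then have IH: "w j = zigzag t (s * int j)" "w (Suc j) = zigzag t (s * int (Suc j))" by auto
    have "if even (Suc j) then (w (Suc j), w (Suc (Suc j))) \<in> D else (w (Suc (Suc j)), w (Suc j)) \<in> D"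
      using alt[of "Suc j"] q[of "Suc j"] Suc.prems by (auto split: if_splits)
    moreover have "even (s * int (Suc j)) \<longleftrightarrow> even (Suc j)" using s by auto
    ultimately have "w (Suc (Suc j)) \<in> {zigzag t (s * int (Suc j) - 1), zigzag t (s * int (Suc j) + 1)}"
      by (intro nbr) (simp only: IH)
    moreover have "{s * int (Suc j) - 1, s * int (Suc j) + 1} = {s * int j, s * int (Suc (Suc j))}"
      using s by auto
    then have "{zigzag t (s * int (Suc j) - 1), zigzag t (s * int (Suc j) + 1)}
        = {zigzag t (s * int j), zigzag t (s * int (Suc (Suc j)))}"
      by (metis (no_types) image_empty image_insert)
    ultimately show ?case using IH skip[OF Suc.prems] by auto
  qed
  have w': "w j = zigzag t (s * int j)" if "j \<le> ?L" for j
    using w[of "j - 1"] z0 ends that by (cases j) auto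
  have "?L = 24"
  proof -
    have "zigzag t 0 = zigzag t (s * int ?L)" using w'[of ?L] ends z0 by simp
    then have "24 dvd int ?L" using s unfolding zigzag_eq_iff by auto
    then have "24 dvd ?L" by presburger
    moreover have "\<not> 24 < ?L"
    proof
      assume "24 < ?L"
      then have "zigzag t s \<noteq> zigzag t (s * 25)"
        using w_neq[of 1 25] w'[of 1] w'[of 25] by auto
      then show False unfolding zigzag_eq_iff using s by auto
    qed
    ultimately show ?thesis using len by (auto elim: dvdE)
  qed
  have "C = (\<lambda>j. {w j, w (Suc j)}) ` {..<?L}"
  proof -
    have "set q = (\<lambda>j. q ! j) ` {..<?L}" by (auto simp: set_conv_nth)
    then have "C = (\<lambda>j. (\<lambda>(u, v). {u, v}) (q ! j)) ` {..<?L}" unfolding C by (simp add: image_image)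
    then show ?thesis using q by simp
  qed
  also have "\<dots> = (\<lambda>j. {zigzag t (s * int j), zigzag t (s * int (Suc j))}) ` {..<24}"
    using w' \<open>?L = 24\<close> by (intro image_cong) auto
  also have "\<dots> = zigzag_edges t" using zigzag_edges_range[OF s, of t 0] by simp
  finally show ?thesis using that by blast
qed

text \<open>A closed walk has to start at a tail. For the converse orientation the heads are the tails, so the walk
  starts one position later.\<close>

lemma zigzag_alternating:
  assumes D': "D' = D \<or> D' = D\<inverse>"
  shows "zigzag_edges t \<in> alternating_cycles G D'"
proof -
  define c :: int where "c = (if D' = D then 0 else 1)"
  define g where "g j = zigzag t (c + int j)" for j
  define q where "q = map (\<lambda>j. (g j, g (Suc j))) [0..<24]"
  have g_arc: "if even j then (g j, g (Suc j)) \<in> D' else (g (Suc j), g j) \<in> D'" for j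
  proof -
    have step: "if even i then (zigzag t i, zigzag t (i + 1)) \<in> D else (zigzag t (i + 1), zigzag t i) \<in> D" for i
    proof (cases "even i")
      case True
      then obtain n where "i = 2 * n" by blast
      then show ?thesis using zigzag_out[of t n "zigzag t (i + 1)"] by simp
    next
      case False
      then obtain n where n: "i = 2 * n + 1" by (blast elim: oddE)
      then show ?thesis using zigzag_in[of "zigzag t (i + 1)" t n] False by (simp add: add.assoc)
    qed
    have "g (Suc j) = zigzag t (c + int j + 1)" by (simp add: g_def algebra_simps)
    then show ?thesis
      using step[of "c + int j"] D' unfolding g_def c_def by (auto split: if_splits)
  qed
  have arcs: "(g j, g (Suc j)) \<in> parcs G" for j
    using g_arc[of j] D' unfolding arcs_G by (auto split: if_splits)
  have walk: "pcas (g 0) q (g 24)" "pawalk_verts (g 0) q = map g [0..<25]"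
    using pcas_map[of g 0 24] unfolding q_def by (simp_all add: eval_nat_numeral)
  have "g 24 = g 0" by (simp add: g_def zigzag_eq_iff)
  then have "pre_digraph.awalk (with_proj G) (g 0) q (g 0)"
    using walk(1) arcs wf_G unfolding pre_digraph.awalk_def cas_with_proj_eq q_def by auto
  moreover have "distinct (tl (pawalk_verts (g 0) q))"
  proof -
    have "inj_on g {1..<25}"
    proof (rule inj_onI)
      fix a b :: nat assume ab: "a \<in> {1..<25}" "b \<in> {1..<25}" and "g a = g b"
      then have "24 dvd int b - int a" unfolding g_def zigzag_eq_iff by simp
      then show "a = b" using ab by (intro eq_if_dvd_diff) auto
    qed
    then have "distinct (map g [1..<25])" unfolding distinct_map by simp
    then show ?thesis unfolding walk(2) by (simp add: map_tl[symmetric])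
  qed
  moreover have "q \<noteq> []" by (simp add: q_def)
  ultimately have "pre_digraph.cycle (with_proj G) q"
    unfolding pre_digraph.cycle_def awalk_verts_with_proj_eq by blast
  moreover have "\<forall>i < length q. if even i then q ! i \<in> D' else prod.swap (q ! i) \<in> D'"
    using g_arc by (auto simp: q_def)
  moreover have "zigzag_edges t = (\<lambda>(u, v). {u, v}) ` set q"
  proof -
    have "zigzag_edges t = (\<lambda>j. {g j, g (Suc j)}) ` {..<24}"
      unfolding g_def using zigzag_edges_range[of 1 t c] by simp
    then show ?thesis by (simp add: q_def image_image lessThan_atLeast0)
  qed
  moreover have "length q = 24" by (simp add: q_def)
  ultimately show ?thesis
    unfolding alternating_cycles_def by (intro CollectI exI[of _ q]) auto
qed

end

section \<open>Radius and attachment number\<close>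

context voltage_prime begin

lemma invariant_orientation_D: "invariant_orientation G D"
  unfolding invariant_orientation_def
  using arcs_G D_asym automorphism_D by auto

lemma alternating_cycles_D: "alternating_cycles G D = range zigzag_edges"
  using alternating_cycle_zigzag zigzag_alternating by blast

lemma has_radius_12: "has_radius G 12"
  unfolding has_radius_def
  using invariant_orientation_D by (intro exI[of _ D]) (auto simp: alternating_cycles_D card_zigzag_edges)

text \<open>The tails and heads of the first zigzag have \<open>k\<close> and \<open>k + 1\<close> as third coordinate, those of the
  second \<open>k + 1\<close> and \<open>k + 2\<close>. So only a head of the first can be a tail of the second. With \<open>n\<close>,
  \<open>n'\<close> counting the step pairs, this happens iff 4 divides \<open>n' - n\<close> and 48 divides
  \<open>8 (n' - n) + 12 n\<close>, which leaves the heads with \<open>n\<close> divisible by 4.\<close>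

lemma consecutive_meet:
  "zigzag t j \<in> range (zigzag (go Ring t)) \<longleftrightarrow> 8 dvd j - 1"
proof -
  obtain i m k where t: "t = (i, m, k)" by (cases t)
  have key: "vtx (go Ring (tail_at t n)) = vtx (tail_at (go Ring t) n') \<longleftrightarrow>
      4 dvd n' - n \<and> 48 dvd 8 * (n' - n) + 12 * n" for n n'
  proof -
    let ?e = "(m + 1 + 12 * i) + 2 * n' + 12 * n' * i - 6 * (n' * (n' - 1))
      - (m + 2 * n + 12 * n * i - 6 * (n * (n - 1)) + 1 + 12 * (i - n))"
    have "vtx (go Ring (tail_at t n)) = vtx (tail_at (go Ring t) n') \<longleftrightarrow> 4 dvd n' - n \<and> 48 dvd ?e"
      by (simp add: t vtx_eq_iff dvd_diff_commute)
    moreover have "48 dvd ?e \<longleftrightarrow> 48 dvd 8 * (n' - n) + 12 * n" if "4 dvd n' - n"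
    proof -
      obtain s where "n' - n = 4 * s" using \<open>4 dvd n' - n\<close> by (rule dvdE)
      then have s: "n' = n + 4 * s" by simp
      have e: "?e = 8 * (n' - n) + 12 * n + 48 * (i * s - 2 * s * s - n * s)"
        unfolding s by (simp add: algebra_simps)
      show ?thesis unfolding e by (rule dvd_add_left_iff) simp
    qed
    ultimately show ?thesis by blast
  qed
  have level: "zigzag t j = zigzag (go Ring t) j' \<Longrightarrow> odd j \<and> even j'" for j'
    using small_multiple[of 1] small_multiple[of 2]
    by (auto simp: zigzag_def t vtx_eq_iff split: if_splits)
  show ?thesis
  proof
    assume "zigzag t j \<in> range (zigzag (go Ring t))"
    then obtain j' where j': "zigzag t j = zigzag (go Ring t) j'" by blast
    define n n' where "n = j div 2" and "n' = j' div 2"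
    have "j = 2 * n + 1" "j' = 2 * n'" using level[OF j'] by (simp_all add: n_def n'_def)
    then have "4 dvd n' - n \<and> 48 dvd 8 * (n' - n) + 12 * n" using j' key[of n n'] by simp
    then have "4 dvd n" by presburger
    then show "8 dvd j - 1" unfolding \<open>j = 2 * n + 1\<close> by auto
  next
    assume "8 dvd j - 1"
    then obtain c where "j - 1 = 8 * c" by (rule dvdE)
    then have j: "j = 2 * (4 * c) + 1" by simp
    have "vtx (go Ring (tail_at t (4 * c))) = vtx (tail_at (go Ring t) (4 * c))"
      unfolding key by simp
    then have "zigzag t j = zigzag (go Ring t) (2 * (4 * c))"
      unfolding j zigzag_odd zigzag_even .
    then show "zigzag t j \<in> range (zigzag (go Ring t))" by blast
  qed
qed

lemma card_consecutive_meet: "card (range (zigzag t) \<inter> range (zigzag (go Ring t))) = 3"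
proof -
  have "range (zigzag t) \<inter> range (zigzag (go Ring t)) = zigzag t ` {j. 8 dvd j - 1}"
    using consecutive_meet by blast
  also have "\<dots> = zigzag t ` {1, 9, 17}"
  proof (intro equalityI subsetI)
    fix x assume "x \<in> zigzag t ` {j. 8 dvd j - 1}"
    then obtain j where j: "x = zigzag t j" "8 dvd j - 1" by blast
    then have "24 dvd 1 - j \<or> 24 dvd 9 - j \<or> 24 dvd 17 - j" by presburger
    then have "x = zigzag t 1 \<or> x = zigzag t 9 \<or> x = zigzag t 17" unfolding j(1) zigzag_eq_iff .
    then show "x \<in> zigzag t ` {1, 9, 17}" by (elim disjE) simp_all
  qed auto
  also have "card \<dots> = 3"
  proof -
    have "inj_on (zigzag t) {1, 9, 17}" by (auto simp: inj_on_def zigzag_eq_iff)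
    then show ?thesis by (simp add: card_image)
  qed
  finally show ?thesis .
qed

lemma range_zigzag_shift: "range (zigzag (tail_at t n)) = range (zigzag t)"
  using zigzag_edges_shift[of t n] unfolding Union_zigzag[symmetric] by simp

lemma meet_head_tail:
  assumes "zigzag t a = zigzag t' b" "odd a" "even b"
  shows "card (range (zigzag t) \<inter> range (zigzag t')) = 3"
proof -
  let ?T = "tail_at t (a div 2)" and ?T' = "tail_at t' (b div 2)"
  have "vtx (go Ring ?T) = vtx ?T'" using assms by (simp add: zigzag_def)
  then have "zigzag ?T' = zigzag (go Ring ?T)" by (intro zigzag_cong) simp
  then have "range (zigzag t') = range (zigzag (go Ring ?T))"
    using range_zigzag_shift[of t' "b div 2"] by simp
  then show ?thesis
    using card_consecutive_meet[of ?T] range_zigzag_shift[of t "a div 2"] by simp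
qed

text \<open>A common vertex that is a tail of both cycles, or a head of both, would make them equal. Otherwise
  the zigzags can be restarted so that one begins at the head of the first arc of the other.\<close>

lemma attachment_3:
  assumes "adjacent_cycles (zigzag_edges t) (zigzag_edges t')"
  shows "card (\<Union>(zigzag_edges t) \<inter> \<Union>(zigzag_edges t')) = 3"
proof -
  have ne: "zigzag_edges t \<noteq> zigzag_edges t'"
    and "range (zigzag t) \<inter> range (zigzag t') \<noteq> {}"
    using assms unfolding adjacent_cycles_def Union_zigzag by auto
  from this(2) obtain x where "x \<in> range (zigzag t)" "x \<in> range (zigzag t')" by blast
  then obtain a b where ab: "zigzag t a = zigzag t' b" by (metis imageE)
  have "odd a \<noteq> odd b"
  proof
    assume "odd a = odd b"
    then have "vtx (tail_at t (a div 2)) = vtx (tail_at t' (b div 2))"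
      using ab by (auto simp: zigzag_def vtx_go_eq_iff split: if_splits)
    then show False
      using ne zigzag_edges_cong zigzag_edges_shift by metis
  qed
  then consider "odd a" "even b" | "odd b" "even a" by blast
  then show ?thesis
    unfolding Union_zigzag using meet_head_tail ab by cases (metis, metis Int_commute)
qed

lemma adjacent_consecutive: "adjacent_cycles (zigzag_edges t) (zigzag_edges (go Ring t))"
proof -
  have "zigzag t 0 \<notin> range (zigzag (go Ring t))" "zigzag t 1 \<in> range (zigzag (go Ring t))"
    unfolding consecutive_meet by simp_all
  then have "range (zigzag t) \<noteq> range (zigzag (go Ring t))"
    "range (zigzag t) \<inter> range (zigzag (go Ring t)) \<noteq> {}" by blast+
  then show ?thesis
    unfolding adjacent_cycles_def Union_zigzag[symmetric] by metis
qed

lemma has_attachment_number_3: "has_attachment_number G 3"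
  unfolding has_attachment_number_def
proof (intro exI[of _ D] conjI ballI impI)
  show "invariant_orientation G D" by (rule invariant_orientation_D)
  show "\<exists>C \<in> alternating_cycles G D. \<exists>C' \<in> alternating_cycles G D. adjacent_cycles C C'"
    unfolding alternating_cycles_D using adjacent_consecutive by blast
  fix C C' assume "C \<in> alternating_cycles G D" "C' \<in> alternating_cycles G D" "adjacent_cycles C C'"
  then show "card (\<Union>C \<inter> \<Union>C') = 3"
    unfolding alternating_cycles_D using attachment_3 by blast
qed

text \<open>The automorphism group is transitive on \<open>D\<close>, so an invariant orientation that contains one arc of \<open>D\<close>
  contains them all.\<close>

lemma invariant_orientation_unique:
  assumes "invariant_orientation G D'" shows "D' = D \<or> D' = D\<inverse>"
proof -
  have D': "D' \<union> D'\<inverse> = D \<union> D\<inverse>" "D' \<inter> D'\<inverse> = {}"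
    using assms by (simp_all add: invariant_orientation_def arcs_G)
  have inv: "(f u, f v) \<in> D'" if "f \<in> automorphisms G" "(u, v) \<in> D'" for f u v
    using assms that unfolding invariant_orientation_def by fast
  obtain u v where uv: "(u, v) \<in> D" using D_step[of Ring] forward_simps by blast
  have all: "(x, y) \<in> D \<Longrightarrow> \<exists>f \<in> automorphisms G. f u = x \<and> f v = y" for x y
    using D_transitive[OF uv] by blast
  have "(u, v) \<in> D' \<or> (v, u) \<in> D'" using uv D'(1) by blast
  then have "D \<subseteq> D' \<or> D \<subseteq> D'\<inverse>"
  proof
    assume "(u, v) \<in> D'"
    then have "D \<subseteq> D'" using all inv by (intro subrelI) metis
    then show ?thesis ..
  next
    assume "(v, u) \<in> D'"
    then have "D \<subseteq> D'\<inverse>" using all inv by (intro subrelI converseI) metis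
    then show ?thesis ..
  qed
  then show ?thesis
  proof
    assume s: "D \<subseteq> D'"
    have "D' \<subseteq> D"
    proof (rule subrelI)
      fix x y assume "(x, y) \<in> D'"
      then show "(x, y) \<in> D" using s D' by blast
    qed
    then show ?thesis using s by blast
  next
    assume s: "D \<subseteq> D'\<inverse>"
    have "D' \<subseteq> D\<inverse>"
    proof (rule subrelI)
      fix x y assume "(x, y) \<in> D'"
      then show "(x, y) \<in> D\<inverse>" using s D' by blast
    qed
    then show ?thesis using s by blast
  qed
qed

lemma not_tightly_attached: "\<not> tightly_attached G"
proof
  assume "tightly_attached G"
  then obtain r D1 D2 where D1: "invariant_orientation G D1" "\<forall>C \<in> alternating_cycles G D1. card C = 2 * r"
    and D2: "invariant_orientation G D2"
      "\<forall>C \<in> alternating_cycles G D2. \<forall>C' \<in> alternating_cycles G D2.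
         adjacent_cycles C C' \<longrightarrow> card (\<Union>C \<inter> \<Union>C') = r"
    unfolding tightly_attached_def has_radius_def has_attachment_number_def by blast
  have in1: "zigzag_edges t \<in> alternating_cycles G D1" and in2: "zigzag_edges t \<in> alternating_cycles G D2" for t
    using invariant_orientation_unique[OF D1(1)] invariant_orientation_unique[OF D2(1)] zigzag_alternating by blast+
  have "card (zigzag_edges (0, 0, 0)) = 2 * r" using D1(2) in1 by blast
  then have "r = 12" by (simp add: card_zigzag_edges)
  have adj: "adjacent_cycles (zigzag_edges (0, 0, 0)) (zigzag_edges (go Ring (0, 0, 0)))"
    by (rule adjacent_consecutive)
  then have "r = 3" using D2(2) in2 attachment_3[OF adj] by metis
  then show False using \<open>r = 12\<close> by simp
qed

end

section \<open>The infinite family\<close>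

lemma card_C_cover: "card (pverts (C_cover p)) = 192 * p"
  by (simp add: C_cover_def unit_voltage_cover_def underlying_graph_def Y_verts_def)

lemma card_verts_digraph_iso:
  assumes "digraph_iso G H" shows "card (verts G) = card (verts H)"
proof -
  obtain h where h: "pre_digraph.digraph_isomorphism G h" "H = app_iso h G"
    using assms unfolding digraph_iso_def by blast
  then show ?thesis
    using pre_digraph.digraph_isomorphism_inj_on_verts[OF h(1)] by (simp add: card_image)
qed
theorem mainTheorem4:
  shows "(\<forall>p::nat. prime p \<and> 5 \<le> p \<longrightarrow>
            connected_quartic_half_arc_transitive (C_cover p) \<and>
            class_II_weak_metacirculant (C_cover p) \<and>
            has_radius (C_cover p) 12 \<and>
            has_attachment_number (C_cover p) 3) \<and>
         (\<exists>\<G> :: ((nat \<times> nat) \<times> nat) pair_pre_digraph set.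
            infinite \<G> \<and>
            pairwise (\<lambda>G H. \<not> digraph_iso (with_proj G) (with_proj H)) \<G> \<and>
            (\<forall>G \<in> \<G>. connected_quartic_half_arc_transitive G \<and>
                      class_II_weak_metacirculant G \<and>
                      \<not> tightly_attached G))"
proof -
  let ?P = "{p::nat. prime p \<and> 5 \<le> p}"
  have props: "connected_quartic_half_arc_transitive (C_cover p)" "class_II_weak_metacirculant (C_cover p)"
    "has_radius (C_cover p) 12" "has_attachment_number (C_cover p) 3" "\<not> tightly_attached (C_cover p)"
    if "p \<in> ?P" for p
  proof -
    interpret voltage_prime p using that by unfold_locales auto
    show "connected_quartic_half_arc_transitive (C_cover p)" "class_II_weak_metacirculant (C_cover p)"
      "has_radius (C_cover p) 12" "has_attachment_number (C_cover p) 3" "\<not> tightly_attached (C_cover p)"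
      by (fact quartic_half_arc_transitive class_II_G has_radius_12 has_attachment_number_3 not_tightly_attached)+
  qed
  have iso: "p = q" if "C_cover p = C_cover q" for p q
  proof -
    have "192 * p = 192 * q"
      unfolding card_C_cover[symmetric] that ..
    then show ?thesis by simp
  qed
  have "?P = {p. prime p} - {..<5}" by auto
  then have "infinite ?P" using primes_infinite by (simp add: Diff_infinite_finite)
  then have "infinite (C_cover ` ?P)" using iso by (simp add: finite_image_iff inj_on_def)
  moreover have "pairwise (\<lambda>G H. \<not> digraph_iso (with_proj G) (with_proj H)) (C_cover ` ?P)"
  proof (rule pairwiseI, elim imageE, intro notI)
    fix G H p q assume "G = C_cover p" "H = C_cover q" "G \<noteq> H" "digraph_iso (with_proj G) (with_proj H)"
    then show False using card_verts_digraph_iso[of "with_proj G" "with_proj H"] by (auto simp: card_C_cover)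
  qed
  ultimately show ?thesis
    using props by (intro conjI allI impI exI[of _ "C_cover ` ?P"] ballI) auto
qed

end
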